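(* Let $(\mathcal O,\mathcal C,\mathbf 2_{\mathcal C},\iota_{\mathcal C})$ be a total SFC-category. Then: (1) $\mathsf{Fix}_{\mathcal I}(\mathbf{Top}_{\mathcal I})=\mathbf{Sob}$, the category of sober spaces; (2) $\mathsf{Fix}_{\mathcal T}(\mathbf{Top}_{\mathcal T})\subseteq\mathbf{Top}_D$, the category of $T_D$-spaces.
   Context: $\mathbf{Frm}$ is the category of frames and frame homomorphisms, $\mathbf 2=\{0<1\}$, $\mathbf{Top}$ ($\mathbf{Top}_0$) the category of ($T_0$) topological spaces, $\mathbb S$ the Sierpinski space ($\{0,1\}$ with opens $\emptyset,\{1\},\{0,1\}$); $|\cdot|$ denotes underlying sets and functions. $X$ is sober if the canonical map $X\to\mathsf{pt}\,\Omega X$ is a homeomorphism ($\mathsf{pt}(L)=\mathbf{Frm}(L,\mathbf 2)$ with opens $\{f\mid f(a)=1\}$). $X$ is $T_D$ if every point is the intersection of an open and a closed set. Lifts. Let $U:\mathcal A\to\mathcal B$ be faithful. A morphism $f:U(A)\to U(A')$ lifts if $f=U(p)$ for a (unique) $p$, its lift. A cartesian lift w.r.t. $U$ of a family $\{f_i:X\to U(C)\}$ is a pair $(\overline X,\theta)$, $\overline X\in\mathcal A$, $\theta:U(\overline X)\to X$ an isomorphism, such that for every $D$ a morphism $h:U(D)\to U(\overline X)$ lifts iff every $f_i\theta h$ lifts. A PFC-category is a quadruple $(\mathcal O,\mathcal C,\mathbf 2_{\mathcal C},\iota_{\mathcal C})$ with $\mathcal O:\mathcal C\to\mathbf{Frm}$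 faithful, $\mathbf 2_{\mathcal C}\in\mathcal C$, $\iota_{\mathcal C}:\mathcal O(\mathbf 2_{\mathcal C})\cong\mathbf 2$. $\mathbf{Top}_{\mathcal C}\subseteq\mathbf{Top}$ is the full subcategory of spaces $X$ for which $\{|\iota_{\mathcal C}^{-1}|\circ\chi_x:\mathbf{Top}(X,\mathbb S)\to|\mathcal O(\mathbf 2_{\mathcal C})|\mid x\in X\}$, $\chi_x(g)=g(x)$, has a cartesian lift $(\Omega_{\mathcal C}X,\theta_X)$ w.r.t. $|\mathcal O(-)|:\mathcal C\to\mathbf{Set}$; $\overline{\chi_x}$ is the lift of $|\iota_{\mathcal C}^{-1}|\circ\chi_x\circ\theta_X$. $\mathsf{pt}_{\mathcal C}(C)$ is $\mathcal C(C,\mathbf 2_{\mathcal C})$ with opens $\{f\mid\iota_{\mathcal C}(\mathcal Of(a))=1\}$, $a\in\mathcal O(C)$. It is an SFC-category if $\mathbb S$ and all $\mathsf{pt}_{\mathcal C}(C)$ are in $\mathbf{Top}_{\mathcal C}$. Then there is an adjunction $\mathsf{pt}_{\mathcal C}\dashv\Omega_{\mathcal C}$ between $\mathcal C$ and $\mathbf{Top}_{\mathcal C}^{\mathrm{op}}$ with unit on the space side $\sigma^{\mathcal C}_X:X\to\mathsf{pt}_{\mathcal C}\Omega_{\mathcal C}X$, $x\mapsto\overline{\chi_x}$; $\mathsf{Fix}(\mathbf{Top}_{\mathcal C})$ is the full subcategory of $X\in\mathbf{Top}_{\mathcal C}$ with $\sigma^{\mathcal C}_X$ a homeomorphism. The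 fiber $\mathcal O^{-1}(L)$ is the preorder of pairs $(C,\theta^C)$, $\theta^C:\mathcal O(C)\cong L$, with $(C,\theta^C)\le(D,\theta^D)$ iff there is $p:C\to D$ with $\theta^D\circ\mathcal O(p)=\theta^C$. $C$ is fiber-initial (fiber-terminal) if $(C,\mathrm{id})$ is a bottom (top) element of $\mathcal O^{-1}(\mathcal O(C))$. $I_{\mathcal I}:\mathcal C_{\mathcal I}\to\mathcal C$ and $I_{\mathcal T}:\mathcal C_{\mathcal T}\to\mathcal C$ are the inclusions of the full subcategories of fiber-initial, respectively fiber-terminal, objects. If $\mathbf 2_{\mathcal C}$ is in $\mathcal C_{\mathcal I}$ (resp. $\mathcal C_{\mathcal T}$), $\mathbf{Top}_{\mathcal I}$ (resp. $\mathbf{Top}_{\mathcal T}$) denotes $\mathbf{Top}_{\mathcal D}$ for $\mathcal D$ the PFC-category $(\mathcal OI_{\mathcal I},\mathcal C_{\mathcal I},\mathbf 2_{\mathcal C},\iota_{\mathcal C})$ (resp. $(\mathcal OI_{\mathcal T},\mathcal C_{\mathcal T},\mathbf 2_{\mathcal C},\iota_{\mathcal C})$); for a total SFC-category both are SFC-categories, and $\mathsf{Fix}_{\mathcal I}(\mathbf{Top}_{\mathcal I})$, $\mathsf{Fix}_{\mathcal T}(\mathbf{Top}_{\mathcal T})$ are the corresponding categories of fixed spaces. An SFC-category is total if: (T1) $\mathbf{Top}_{\mathcal C}=\mathbf{Top}$ and $\mathsf{Fix}(\mathbf{Top}_{\mathcal C})=\mathbf{Top}_0$; (T2) $\mathbf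 2_{\mathcal C}$ and $\Omega_{\mathcal C}\mathbb S$ are both fiber-initial and fiber-terminal; (T3) $\mathcal O$ has a left adjoint with invertible unit; (T4) $\mathsf{pt}_{\mathcal C}(C)\in\mathbf{Top}_{\mathcal T}$ for all $C\in\mathcal C_{\mathcal T}$. *)

theory Defs
  imports "HOL-Analysis.Analysis" "HOL-Algebra.Complete_Lattice"
begin

section \<open>Smallness\<close>

text \<open>
  The classes of all sets, frames and spaces are taken relative to a universe: a family \<open>\<U>\<close> of
  \<open>small\<close> subsets of a type \<open>'u\<close> with the closure properties of a Grothendieck universe, powersets
  being represented up to bijection.  Infinity is not required; in particular the finite subsets
  of any infinite type form a universe.
\<close>

locale universe =
  fixes \<U> :: "'u set set"
  assumes empty_small: "{} \<in> \<U>"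
    and subset_small: "A \<in> \<U> \<Longrightarrow> B \<subseteq> A \<Longrightarrow> B \<in> \<U>"
    and image_small: "A \<in> \<U> \<Longrightarrow> f ` A \<in> \<U>"
    and Pow_small: "A \<in> \<U> \<Longrightarrow> \<exists>B\<in>\<U>. Pow A \<approx> B"
    and UN_small: "A \<in> \<U> \<Longrightarrow> (\<And>a. a \<in> A \<Longrightarrow> F a \<in> \<U>) \<Longrightarrow> (\<Union>a\<in>A. F a) \<in> \<U>"

text \<open>
  Smallness of sets over an arbitrary type.  It lets the Sierpinski space (carried by \<open>bool\<close>) and
  the spaces of points (carried by arrows) be small spaces as they are, without encoding them in \<open>'u\<close>.
\<close>

definition small :: "'u set set \<Rightarrow> 'x set \<Rightarrow> bool" where
  "small \<U> A \<longleftrightarrow> (\<exists>B\<in>\<U>. A \<approx> B)"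

lemma (in universe) small_iff: "small \<U> (A :: 'u set) \<longleftrightarrow> A \<in> \<U>"
proof
  assume "small \<U> A"
  then obtain B g where "B \<in> \<U>" "bij_betw g B A"
    unfolding small_def by (meson eqpoll_def eqpoll_sym)
  then show "A \<in> \<U>"
    using image_small by (metis bij_betw_imp_surj_on)
qed (auto simp: small_def)

lemma universe_finite:
  assumes "infinite (UNIV :: 'u set)"
  shows "universe {A :: 'u set. finite A}"
proof
  fix A :: "'u set"
  assume "A \<in> {A. finite A}"
  then have "finite (Pow A)" by simp
  moreover obtain B :: "'u set" where "finite B" "card B = card (Pow A)"
    using infinite_arbitrarily_large[OF assms] by blast
  ultimately show "\<exists>B\<in>{A :: 'u set. finite A}. Pow A \<approx> B"
    by (metis eqpoll_iff_card mem_Collect_eq)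
qed (auto intro: finite_subset)


section \<open>Categories, functors and adjunctions\<close>

text \<open>
  The hom-sets need not be disjoint, so \<open>Comp C a b c g f\<close>, the composite of \<open>f : a \<rightarrow> b\<close> and
  \<open>g : b \<rightarrow> c\<close>, takes the three objects as arguments; likewise the arrow part of a functor.
\<close>

record ('o, 'm) category =
  Ob :: "'o set"
  Hom :: "'o \<Rightarrow> 'o \<Rightarrow> 'm set"
  Ide :: "'o \<Rightarrow> 'm"
  Comp :: "'o \<Rightarrow> 'o \<Rightarrow> 'o \<Rightarrow> 'm \<Rightarrow> 'm \<Rightarrow> 'm"

definition is_category :: "('o, 'm) category \<Rightarrow> bool" where
  "is_category C \<longleftrightarrow>
     (\<forall>a\<in>Ob C. Ide C a \<in> Hom C a a) \<and>
     (\<forall>a\<in>Ob C. \<forall>b\<in>Ob C. \<forall>c\<in>Ob C. \<forall>f\<in>Hom C a b. \<forall>g\<in>Hom C b c. Comp C a b c g f \<in> Hom C a c) \<and>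
     (\<forall>a\<in>Ob C. \<forall>b\<in>Ob C. \<forall>f\<in>Hom C a b.
        Comp C a a b f (Ide C a) = f \<and> Comp C a b b (Ide C b) f = f) \<and>
     (\<forall>a\<in>Ob C. \<forall>b\<in>Ob C. \<forall>c\<in>Ob C. \<forall>d\<in>Ob C. \<forall>f\<in>Hom C a b. \<forall>g\<in>Hom C b c. \<forall>h\<in>Hom C c d.
        Comp C a c d h (Comp C a b c g f) = Comp C a b d (Comp C b c d h g) f)"

definition full_subcategory :: "('o, 'm) category \<Rightarrow> ('o \<Rightarrow> bool) \<Rightarrow> ('o, 'm) category" where
  "full_subcategory C S = C\<lparr>Ob := {a \<in> Ob C. S a}\<rparr>"

definition is_iso :: "('o, 'm) category \<Rightarrow> 'o \<Rightarrow> 'o \<Rightarrow> 'm \<Rightarrow> bool" where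
  "is_iso C a b f \<longleftrightarrow> f \<in> Hom C a b \<and>
     (\<exists>g\<in>Hom C b a. Comp C a b a g f = Ide C a \<and> Comp C b a b f g = Ide C b)"

definition is_functor ::
  "('o, 'm) category \<Rightarrow> ('p, 'n) category \<Rightarrow> ('o \<Rightarrow> 'p) \<Rightarrow> ('o \<Rightarrow> 'o \<Rightarrow> 'm \<Rightarrow> 'n) \<Rightarrow> bool" where
  "is_functor C D G0 G1 \<longleftrightarrow>
     (\<forall>a\<in>Ob C. G0 a \<in> Ob D) \<and>
     (\<forall>a\<in>Ob C. \<forall>b\<in>Ob C. \<forall>f\<in>Hom C a b. G1 a b f \<in> Hom D (G0 a) (G0 b)) \<and>
     (\<forall>a\<in>Ob C. G1 a a (Ide C a) = Ide D (G0 a)) \<and>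
     (\<forall>a\<in>Ob C. \<forall>b\<in>Ob C. \<forall>c\<in>Ob C. \<forall>f\<in>Hom C a b. \<forall>g\<in>Hom C b c.
        G1 a c (Comp C a b c g f) = Comp D (G0 a) (G0 b) (G0 c) (G1 b c g) (G1 a b f))"

definition is_faithful :: "('o, 'm) category \<Rightarrow> ('o \<Rightarrow> 'o \<Rightarrow> 'm \<Rightarrow> 'n) \<Rightarrow> bool" where
  "is_faithful C G1 \<longleftrightarrow> (\<forall>a\<in>Ob C. \<forall>b\<in>Ob C. inj_on (G1 a b) (Hom C a b))"

definition is_left_adjoint ::
  "('o, 'm) category \<Rightarrow> ('p, 'n) category \<Rightarrow> ('o \<Rightarrow> 'p) \<Rightarrow> ('o \<Rightarrow> 'o \<Rightarrow> 'm \<Rightarrow> 'n) \<Rightarrow>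
   ('p \<Rightarrow> 'o) \<Rightarrow> ('p \<Rightarrow> 'p \<Rightarrow> 'n \<Rightarrow> 'm) \<Rightarrow> ('p \<Rightarrow> 'n) \<Rightarrow> bool" where
  \<comment> \<open>\<open>F : D \<rightarrow> C\<close> is left adjoint to \<open>G : C \<rightarrow> D\<close> with unit \<open>\<eta> : id \<rightarrow> G F\<close>\<close>
  "is_left_adjoint C D G0 G1 F0 F1 \<eta> \<longleftrightarrow>
     is_functor D C F0 F1 \<and>
     (\<forall>d\<in>Ob D. \<eta> d \<in> Hom D d (G0 (F0 d))) \<and>
     (\<forall>d\<in>Ob D. \<forall>d'\<in>Ob D. \<forall>f\<in>Hom D d d'.
        Comp D d d' (G0 (F0 d')) (\<eta> d') f =
        Comp D d (G0 (F0 d)) (G0 (F0 d')) (G1 (F0 d) (F0 d') (F1 d d' f)) (\<eta> d)) \<and>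
     (\<forall>d\<in>Ob D. \<forall>c\<in>Ob C. \<forall>f\<in>Hom D d (G0 c).
        \<exists>!g. g \<in> Hom C (F0 d) c \<and> Comp D d (G0 (F0 d)) (G0 c) (G1 (F0 d) c g) (\<eta> d) = f)"


section \<open>Frames\<close>

locale frame = complete_lattice L for L (structure) +
  assumes meet_Sup_distrib:
    "a \<in> carrier L \<Longrightarrow> B \<subseteq> carrier L \<Longrightarrow> a \<sqinter> (\<Squnion>B) = \<Squnion>((\<lambda>b. a \<sqinter> b) ` B)"

definition frame_hom :: "'a gorder \<Rightarrow> 'b gorder \<Rightarrow> ('a \<Rightarrow> 'b) set" where
  "frame_hom L M =
     {f \<in> carrier L \<rightarrow>\<^sub>E carrier M.
        (\<forall>A. A \<subseteq> carrier L \<longrightarrow> f (\<Squnion>\<^bsub>L\<^esub> A) = \<Squnion>\<^bsub>M\<^esub> (f ` A)) \<and>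
        (\<forall>a\<in>carrier L. \<forall>b\<in>carrier L. f (a \<sqinter>\<^bsub>L\<^esub> b) = f a \<sqinter>\<^bsub>M\<^esub> f b) \<and>
        f \<top>\<^bsub>L\<^esub> = \<top>\<^bsub>M\<^esub>}"

abbreviation frame_id :: "'a gorder \<Rightarrow> 'a \<Rightarrow> 'a" where
  "frame_id L \<equiv> (\<lambda>a\<in>carrier L. a)"

definition frame_iso :: "'a gorder \<Rightarrow> 'b gorder \<Rightarrow> ('a \<Rightarrow> 'b) \<Rightarrow> bool" where
  "frame_iso L M f \<longleftrightarrow> f \<in> frame_hom L M \<and>
     (\<exists>g\<in>frame_hom M L. compose (carrier L) g f = frame_id L \<and> compose (carrier M) f g = frame_id M)"

definition Frm :: "'u set set \<Rightarrow> ('u gorder, 'u \<Rightarrow> 'u) category" where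
  "Frm \<U> = \<lparr>Ob = {L. frame L \<and> small \<U> (carrier L)}, Hom = frame_hom, Ide = frame_id,
            Comp = (\<lambda>K L M g f. compose (carrier K) g f)\<rparr>"

definition two_frame :: "bool gorder" where
  "two_frame = \<lparr>carrier = UNIV, eq = (=), le = (\<le>)\<rparr>"

definition frame_of_opens :: "'x topology \<Rightarrow> 'x set gorder" where
  "frame_of_opens X = \<lparr>carrier = {U. openin X U}, eq = (=), le = (\<subseteq>)\<rparr>"

definition pt :: "'a gorder \<Rightarrow> ('a \<Rightarrow> bool) topology" where
  "pt L = topology (\<lambda>U. \<exists>a\<in>carrier L. U = {f \<in> frame_hom L two_frame. f a})"


section \<open>Spaces\<close>

text \<open>Full subcategories of the category of spaces are given by their classes of objects.\<close>

definition Top :: "'u set set \<Rightarrow> 'x topology set" where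
  "Top \<U> = {X. small \<U> (topspace X)}"

definition Top\<^sub>0 :: "'u set set \<Rightarrow> 'x topology set" where
  "Top\<^sub>0 \<U> = {X \<in> Top \<U>. t0_space X}"

definition sober_space :: "'x topology \<Rightarrow> bool" where
  "sober_space X \<longleftrightarrow>
     homeomorphic_map X (pt (frame_of_opens X)) (\<lambda>x. \<lambda>U\<in>carrier (frame_of_opens X). x \<in> U)"

definition Sob :: "'u set set \<Rightarrow> 'x topology set" where
  "Sob \<U> = {X \<in> Top \<U>. sober_space X}"

definition td_space :: "'x topology \<Rightarrow> bool" where
  "td_space X \<longleftrightarrow> (\<forall>x\<in>topspace X. \<exists>U C. openin X U \<and> closedin X C \<and> {x} = U \<inter> C)"

definition Top\<^sub>D :: "'u set set \<Rightarrow> 'x topology set" where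
  "Top\<^sub>D \<U> = {X \<in> Top \<U>. td_space X}"

definition sierpinski :: "bool topology" where
  "sierpinski = topology (\<lambda>U. U \<in> {{}, {True}, UNIV})"

definition Top_hom :: "'x topology \<Rightarrow> 'y topology \<Rightarrow> ('x \<Rightarrow> 'y) set" where
  "Top_hom X Y = {f \<in> topspace X \<rightarrow>\<^sub>E topspace Y. continuous_map X Y f}"


section \<open>PFC-categories\<close>

record ('o, 'm, 'u) pfc =
  cat :: "('o, 'm) category"
  O_ob :: "'o \<Rightarrow> 'u gorder"
  O_arr :: "'o \<Rightarrow> 'o \<Rightarrow> 'm \<Rightarrow> 'u \<Rightarrow> 'u"
  two_ob :: "'o"
  iota :: "'u \<Rightarrow> bool"

locale pfc_category = universe \<U>
  for \<U> :: "'u set set" and P :: "('o, 'm, 'u) pfc" +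
  assumes is_category: "is_category (cat P)"
    and O_functor: "is_functor (cat P) (Frm \<U>) (O_ob P) (O_arr P)"
    and O_faithful: "is_faithful (cat P) (O_arr P)"
    and two_ob: "two_ob P \<in> Ob (cat P)"
    and iota_iso: "frame_iso (O_ob P (two_ob P)) two_frame (iota P)"

subsection \<open>Lifts with respect to the underlying-set functor of \<open>\<O>\<close>\<close>

abbreviation O_set :: "('o, 'm, 'u) pfc \<Rightarrow> 'o \<Rightarrow> 'u set" where
  "O_set P c \<equiv> carrier (O_ob P c)"

definition lifts :: "('o, 'm, 'u) pfc \<Rightarrow> 'o \<Rightarrow> 'o \<Rightarrow> ('u \<Rightarrow> 'u) \<Rightarrow> bool" where
  "lifts P a b h \<longleftrightarrow> (\<exists>p\<in>Hom (cat P) a b. O_arr P a b p = h)"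

definition lift_of :: "('o, 'm, 'u) pfc \<Rightarrow> 'o \<Rightarrow> 'o \<Rightarrow> ('u \<Rightarrow> 'u) \<Rightarrow> 'm" where
  "lift_of P a b h = (THE p. p \<in> Hom (cat P) a b \<and> O_arr P a b p = h)"

definition cartesian_lift ::
  "('o, 'm, 'u) pfc \<Rightarrow> 's set \<Rightarrow> 'o \<Rightarrow> ('s \<Rightarrow> 'u) set \<Rightarrow> 'o \<Rightarrow> ('u \<Rightarrow> 's) \<Rightarrow> bool" where
  \<comment> \<open>\<open>(A, \<theta>)\<close> is a cartesian lift of the family \<open>\<F>\<close> of functions from the set \<open>S\<close> to \<open>|\<O>(c)|\<close>\<close>
  "cartesian_lift P S c \<F> A \<theta> \<longleftrightarrow>
     A \<in> Ob (cat P) \<and> \<theta> \<in> O_set P A \<rightarrow>\<^sub>E S \<and> bij_betw \<theta> (O_set P A) S \<and>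
     (\<forall>D\<in>Ob (cat P). \<forall>h \<in> O_set P D \<rightarrow>\<^sub>E O_set P A.
        lifts P D A h \<longleftrightarrow> (\<forall>f\<in>\<F>. lifts P D c (\<lambda>a\<in>O_set P D. f (\<theta> (h a)))))"

subsection \<open>The category \<open>Top\<^sub>C\<close>, open sets and points\<close>

definition chi :: "('o, 'm, 'u) pfc \<Rightarrow> 'x topology \<Rightarrow> 'x \<Rightarrow> ('x \<Rightarrow> bool) \<Rightarrow> 'u" where
  \<comment> \<open>the composite of the evaluation at \<open>x\<close> with the inverse of \<open>\<iota>\<close>\<close>
  "chi P X x = (\<lambda>g\<in>Top_hom X sierpinski. inv_into (O_set P (two_ob P)) (iota P) (g x))"

definition is_Omega :: "('o, 'm, 'u) pfc \<Rightarrow> 'x topology \<Rightarrow> 'o \<Rightarrow> ('u \<Rightarrow> 'x \<Rightarrow> bool) \<Rightarrow> bool" where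
  "is_Omega P X A \<theta> \<longleftrightarrow>
     cartesian_lift P (Top_hom X sierpinski) (two_ob P) (chi P X ` topspace X) A \<theta>"

definition Top\<^sub>C :: "'u set set \<Rightarrow> ('o, 'm, 'u) pfc \<Rightarrow> 'x topology set" where
  "Top\<^sub>C \<U> P = {X \<in> Top \<U>. \<exists>A \<theta>. is_Omega P X A \<theta>}"

text \<open>A choice of cartesian lift; it is unique up to an isomorphism compatible with \<open>\<theta>\<close>.\<close>

definition Omega_lift :: "('o, 'm, 'u) pfc \<Rightarrow> 'x topology \<Rightarrow> 'o \<times> ('u \<Rightarrow> 'x \<Rightarrow> bool)" where
  "Omega_lift P X = (SOME (A, \<theta>). is_Omega P X A \<theta>)"

definition Omega :: "('o, 'm, 'u) pfc \<Rightarrow> 'x topology \<Rightarrow> 'o" where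
  "Omega P X = fst (Omega_lift P X)"

definition theta :: "('o, 'm, 'u) pfc \<Rightarrow> 'x topology \<Rightarrow> 'u \<Rightarrow> 'x \<Rightarrow> bool" where
  "theta P X = snd (Omega_lift P X)"

definition pt\<^sub>C :: "('o, 'm, 'u) pfc \<Rightarrow> 'o \<Rightarrow> 'm topology" where
  "pt\<^sub>C P A = topology (\<lambda>U. \<exists>a\<in>O_set P A.
     U = {f \<in> Hom (cat P) A (two_ob P). iota P (O_arr P A (two_ob P) f a)})"

definition sigma :: "('o, 'm, 'u) pfc \<Rightarrow> 'x topology \<Rightarrow> 'x \<Rightarrow> 'm" where
  "sigma P X x =
     lift_of P (Omega P X) (two_ob P) (\<lambda>a\<in>O_set P (Omega P X). chi P X x (theta P X a))"

definition Fix :: "'u set set \<Rightarrow> ('o, 'm, 'u) pfc \<Rightarrow> 'x topology set" where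
  "Fix \<U> P = {X \<in> Top\<^sub>C \<U> P. homeomorphic_map X (pt\<^sub>C P (Omega P X)) (sigma P X)}"

locale sfc_category = pfc_category \<U> P
  for \<U> :: "'u set set" and P :: "('o, 'm, 'u) pfc" +
  assumes sierpinski_Top\<^sub>C: "sierpinski \<in> Top\<^sub>C \<U> P"
    and pt\<^sub>C_Top\<^sub>C: "A \<in> Ob (cat P) \<Longrightarrow> pt\<^sub>C P A \<in> Top\<^sub>C \<U> P"

subsection \<open>Fibers\<close>

definition fiber :: "('o, 'm, 'u) pfc \<Rightarrow> 'u gorder \<Rightarrow> ('o \<times> ('u \<Rightarrow> 'u)) set" where
  "fiber P L = {(A, \<theta>). A \<in> Ob (cat P) \<and> frame_iso (O_ob P A) L \<theta>}"

definition fiber_le ::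
  "('o, 'm, 'u) pfc \<Rightarrow> ('o \<times> ('u \<Rightarrow> 'u)) \<Rightarrow> ('o \<times> ('u \<Rightarrow> 'u)) \<Rightarrow> bool" where
  "fiber_le P = (\<lambda>(A, \<theta>) (B, \<phi>).
     \<exists>p\<in>Hom (cat P) A B. compose (O_set P A) \<phi> (O_arr P A B p) = \<theta>)"

definition fiber_initial :: "('o, 'm, 'u) pfc \<Rightarrow> 'o \<Rightarrow> bool" where
  "fiber_initial P A \<longleftrightarrow> A \<in> Ob (cat P) \<and>
     (\<forall>x\<in>fiber P (O_ob P A). fiber_le P (A, frame_id (O_ob P A)) x)"

definition fiber_terminal :: "('o, 'm, 'u) pfc \<Rightarrow> 'o \<Rightarrow> bool" where
  "fiber_terminal P A \<longleftrightarrow> A \<in> Ob (cat P) \<and>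
     (\<forall>x\<in>fiber P (O_ob P A). fiber_le P x (A, frame_id (O_ob P A)))"

definition pfc_I :: "('o, 'm, 'u) pfc \<Rightarrow> ('o, 'm, 'u) pfc" where
  "pfc_I P = P\<lparr>cat := full_subcategory (cat P) (fiber_initial P)\<rparr>"

definition pfc_T :: "('o, 'm, 'u) pfc \<Rightarrow> ('o, 'm, 'u) pfc" where
  "pfc_T P = P\<lparr>cat := full_subcategory (cat P) (fiber_terminal P)\<rparr>"

subsection \<open>Total SFC-categories\<close>

locale total_sfc_category = sfc_category \<U> P
  for \<U> :: "'u set set" and P :: "('o, 'm, 'u) pfc" +
  assumes T1_Top: "Top\<^sub>C \<U> P = (Top \<U> :: 'u topology set)"
    and T1_Fix: "Fix \<U> P = (Top\<^sub>0 \<U> :: 'u topology set)"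
    and T2_two_ob: "fiber_initial P (two_ob P)" "fiber_terminal P (two_ob P)"
    and T2_Omega_sierpinski:
      "fiber_initial P (Omega P sierpinski)" "fiber_terminal P (Omega P sierpinski)"
    and T3: "\<exists>F0 F1 \<eta>. is_left_adjoint (cat P) (Frm \<U>) (O_ob P) (O_arr P) F0 F1 \<eta> \<and>
      (\<forall>L\<in>Ob (Frm \<U>). is_iso (Frm \<U>) L (O_ob P (F0 L)) (\<eta> L))"
    and T4: "fiber_terminal P A \<Longrightarrow> pt\<^sub>C P A \<in> Top\<^sub>C \<U> (pfc_T P)"

section \<open>Consistency checks\<close>

text \<open>
  The orders used above are frames, and the families used to define the Sierpinski space and the
  spaces of points are closed under finite intersections and unions, so that \<open>topology\<close> yields them.
\<close>

lemma openin_sierpinski: "openin sierpinski U \<longleftrightarrow> U \<in> {{}, {True}, UNIV}"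
proof -
  have "istopology (\<lambda>U. U \<in> {{}, {True}, UNIV :: bool set})"
    unfolding istopology_def
  proof (intro conjI allI impI)
    fix K :: "bool set set" assume K: "\<forall>U\<in>K. U \<in> {{}, {True}, UNIV}"
    show "\<Union>K \<in> {{}, {True}, UNIV}"
    proof (cases "UNIV \<in> K")
      case False
      then have "K \<subseteq> {{}, {True}}" using K by auto
      then have "\<Union>K \<subseteq> {True}" by auto
      then show ?thesis by auto
    qed auto
  qed auto
  then show ?thesis unfolding sierpinski_def by (simp add: topology_inverse')
qed

lemma complete_lattice_two: "complete_lattice two_frame"
proof 
  fix A :: "bool set"
  show "\<exists>s. least two_frame s (Upper two_frame A)"
    by (rule exI[of _ "\<exists>x\<in>A. x"]) (auto simp: least_def Upper_def two_frame_def)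
  show "\<exists>s. greatest two_frame s (Lower two_frame A)"
    by (rule exI[of _ "\<forall>x\<in>A. x"]) (auto simp: greatest_def Lower_def two_frame_def)
qed (auto simp: two_frame_def)

lemma two_simps:
  "carrier two_frame = UNIV"
  "\<Squnion>\<^bsub>two_frame\<^esub> A = (\<exists>x\<in>A. x)" "\<top>\<^bsub>two_frame\<^esub> = True" "x \<sqinter>\<^bsub>two_frame\<^esub> y = (x \<and> y)"
proof -
  interpret two: Complete_Lattice.complete_lattice two_frame by (rule complete_lattice_two)
  have l: "le two_frame = (\<le>)" by (simp add: two_frame_def)
  show c: "carrier two_frame = UNIV" by (simp add: two_frame_def)
  show "\<Squnion>\<^bsub>two_frame\<^esub> A = (\<exists>x\<in>A. x)"
    using two.sup_upper[of A True] two.sup_least[of A False] unfolding c l by auto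
  show "\<top>\<^bsub>two_frame\<^esub> = True" 
    using two.top_higher[of True] unfolding c l by auto
  show "x \<sqinter>\<^bsub>two_frame\<^esub> y = (x \<and> y)"
    using two.meet_left[of x y] two.meet_right[of x y] two.meet_le[of "x \<and> y" x y] unfolding c l by auto
qed

lemma frame_two: "frame two_frame"
  by (simp add: frame_def complete_lattice_two frame_axioms_def two_simps)

lemma istopology_pt_aux:
  fixes ev :: "'p \<Rightarrow> 'a \<Rightarrow> bool"
  assumes "Complete_Lattice.complete_lattice L"
    and sup: "\<And>f A. f \<in> H \<Longrightarrow> A \<subseteq> carrier L \<Longrightarrow> ev f (\<Squnion>\<^bsub>L\<^esub> A) = (\<exists>a\<in>A. ev f a)"
    and meet: "\<And>f a b. f \<in> H \<Longrightarrow> a \<in> carrier L \<Longrightarrow> b \<in> carrier L \<Longrightarrow> ev f (a \<sqinter>\<^bsub>L\<^esub> b) = (ev f a \<and> ev f b)"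
  shows "istopology (\<lambda>U. \<exists>a\<in>carrier L. U = {f \<in> H. ev f a})"
proof -
  interpret L: Complete_Lattice.complete_lattice L by fact
  show ?thesis unfolding istopology_def
  proof (intro conjI allI impI)
    fix S T assume "\<exists>a\<in>carrier L. S = {f \<in> H. ev f a}" "\<exists>a\<in>carrier L. T = {f \<in> H. ev f a}"
    then obtain a b where "a \<in> carrier L" "b \<in> carrier L" "S = {f \<in> H. ev f a}" "T = {f \<in> H. ev f b}" by auto
    then show "\<exists>a\<in>carrier L. S \<inter> T = {f \<in> H. ev f a}"
      by (intro bexI[of _ "a \<sqinter>\<^bsub>L\<^esub> b"]) (auto simp: meet)
  next
    fix K assume K: "\<forall>S\<in>K. \<exists>a\<in>carrier L. S = {f \<in> H. ev f a}"
    define A where "A = {a \<in> carrier L. {f \<in> H. ev f a} \<in> K}"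
    have A: "A \<subseteq> carrier L" by (auto simp: A_def)
    have "K = (\<lambda>a. {f \<in> H. ev f a}) ` A"
    proof (intro equalityI subsetI)
      fix S assume S: "S \<in> K"
      then obtain a where a: "a \<in> carrier L" "S = {f \<in> H. ev f a}" using K by metis
      with S have "a \<in> A" by (simp add: A_def)
      with a(2) show "S \<in> (\<lambda>a. {f \<in> H. ev f a}) ` A" by (rule image_eqI)
    qed (auto simp: A_def)
    then have "\<Union>K = {f \<in> H. \<exists>a\<in>A. ev f a}" by blast
    also have "\<dots> = {f \<in> H. ev f (\<Squnion>\<^bsub>L\<^esub> A)}"
      by (simp add: sup[OF _ A] cong: conj_cong)
    finally have "\<Union>K = {f \<in> H. ev f (\<Squnion>\<^bsub>L\<^esub> A)}" .
    moreover have "\<Squnion>\<^bsub>L\<^esub> A \<in> carrier L" by (rule L.sup_closed) (auto simp: A_def)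
    ultimately show "\<exists>a\<in>carrier L. \<Union>K = {f \<in> H. ev f a}" by blast
  qed
qed

lemma frame_homD:
  assumes "f \<in> frame_hom L M"
  shows "a \<in> carrier L \<Longrightarrow> f a \<in> carrier M"
    "A \<subseteq> carrier L \<Longrightarrow> f (\<Squnion>\<^bsub>L\<^esub> A) = \<Squnion>\<^bsub>M\<^esub> (f ` A)"
    "a \<in> carrier L \<Longrightarrow> b \<in> carrier L \<Longrightarrow> f (a \<sqinter>\<^bsub>L\<^esub> b) = f a \<sqinter>\<^bsub>M\<^esub> f b"
    "f \<top>\<^bsub>L\<^esub> = \<top>\<^bsub>M\<^esub>"
  using assms by (auto simp: frame_hom_def)

lemma openin_pt:
  assumes "frame L"
  shows "openin (pt L) U \<longleftrightarrow> (\<exists>a\<in>carrier L. U = {f \<in> frame_hom L two_frame. f a})"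
proof -
  have "istopology (\<lambda>U. \<exists>a\<in>carrier L. U = {f \<in> frame_hom L two_frame. f a})"
  proof (rule istopology_pt_aux)
    fix f A assume "f \<in> frame_hom L two_frame" "A \<subseteq> carrier L"
    from frame_homD(2)[OF this] show "f (\<Squnion>\<^bsub>L\<^esub> A) = (\<exists>a\<in>A. f a)" by (simp add: two_simps)
  next
    fix f a b assume "f \<in> frame_hom L two_frame" "a \<in> carrier L" "b \<in> carrier L"
    from frame_homD(3)[OF this] show "f (a \<sqinter>\<^bsub>L\<^esub> b) = (f a \<and> f b)" by (simp add: two_simps)
  qed (use assms in \<open>simp add: frame_def\<close>)
  then show ?thesis unfolding pt_def by (simp add: topology_inverse')
qed

lemma (in pfc_category) openin_pt\<^sub>C:
  assumes A: "A \<in> Ob (cat P)"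
  shows "openin (pt\<^sub>C P A) U \<longleftrightarrow>
    (\<exists>a\<in>O_set P A. U = {f \<in> Hom (cat P) A (two_ob P). iota P (O_arr P A (two_ob P) f a)})"
proof -
  have fr: "Complete_Lattice.complete_lattice (O_ob P B)" if "B \<in> Ob (cat P)" for B
    using O_functor that by (auto simp: is_functor_def Frm_def frame_def)
  interpret two: Complete_Lattice.complete_lattice "O_ob P (two_ob P)" using fr two_ob .
  have hom: "O_arr P A (two_ob P) f \<in> frame_hom (O_ob P A) (O_ob P (two_ob P))"
    if "f \<in> Hom (cat P) A (two_ob P)" for f
    using O_functor that A two_ob by (auto simp: is_functor_def Frm_def)
  have \<iota>: "iota P \<in> frame_hom (O_ob P (two_ob P)) two_frame"
    using iota_iso by (simp add: frame_iso_def)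
  have "istopology (\<lambda>U. \<exists>a\<in>O_set P A.
      U = {f \<in> Hom (cat P) A (two_ob P). iota P (O_arr P A (two_ob P) f a)})"
  proof (rule istopology_pt_aux)
    fix f B assume "f \<in> Hom (cat P) A (two_ob P)" "B \<subseteq> O_set P A"
    note f = hom[OF this(1)] and B = this(2)
    have "O_arr P A (two_ob P) f ` B \<subseteq> O_set P (two_ob P)"
      using B frame_homD(1)[OF f] by blast
    then show "iota P (O_arr P A (two_ob P) f (\<Squnion>\<^bsub>O_ob P A\<^esub> B)) =
        (\<exists>a\<in>B. iota P (O_arr P A (two_ob P) f a))"
      by (simp add: frame_homD(2)[OF f B] frame_homD(2)[OF \<iota>] two_simps)
  next
    fix f a b assume "f \<in> Hom (cat P) A (two_ob P)" "a \<in> O_set P A" "b \<in> O_set P A"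
    then show "iota P (O_arr P A (two_ob P) f (a \<sqinter>\<^bsub>O_ob P A\<^esub> b)) = (iota P (O_arr P A (two_ob P) f a) \<and> iota P (O_arr P A (two_ob P) f b))"
      by (simp add: frame_homD(1,3)[OF hom] frame_homD(3)[OF \<iota>] two_simps)
  qed (rule fr[OF A])
  then show ?thesis unfolding pt\<^sub>C_def by (simp add: topology_inverse')
qed

lemma frame_opens: "frame (frame_of_opens X)"
proof -
  let ?L = "frame_of_opens X"
  have c: "carrier ?L = {U. openin X U}" and l: "le ?L = (\<subseteq>)" by (auto simp: frame_of_opens_def)
  interpret L: Complete_Lattice.complete_lattice ?L
  proof
    fix A assume A: "A \<subseteq> carrier ?L"
    show "\<exists>s. least ?L s (Upper ?L A)"
      using A by (intro exI[of _ "\<Union>A"]) (auto simp: least_def Upper_def c l)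
    show "\<exists>s. greatest ?L s (Lower ?L A)"
      by (intro exI[of _ "\<Union>{U. openin X U \<and> (\<forall>V\<in>A. U \<subseteq> V)}"])
         (use A in \<open>auto simp: greatest_def Lower_def c l\<close>)
  qed (auto simp: frame_of_opens_def)
  have s: "\<Squnion>\<^bsub>?L\<^esub> A = \<Union>A" if "A \<subseteq> carrier ?L" for A
    using L.sup_upper[of A] L.sup_least[of A "\<Union>A"] that unfolding l c by blast
  have m: "U \<sqinter>\<^bsub>?L\<^esub> V = U \<inter> V" if "openin X U" "openin X V" for U V
    using L.meet_left[of U V] L.meet_right[of U V] L.meet_le[of "U \<inter> V" U V] that unfolding l c by blast
  show ?thesis
  proof
    fix a B assume "a \<in> carrier ?L" and B: "B \<subseteq> carrier ?L"
    then have a: "openin X a" by (simp add: c)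
    have B': "openin X b" if "b \<in> B" for b using that B c by auto
    have "(\<lambda>b. a \<sqinter>\<^bsub>?L\<^esub> b) ` B = (\<lambda>b. a \<inter> b) ` B" using a B' by (auto simp: m)
    moreover have "(\<lambda>b. a \<inter> b) ` B \<subseteq> carrier ?L" using a B' by (auto simp: c)
    ultimately show "a \<sqinter>\<^bsub>?L\<^esub> (\<Squnion>\<^bsub>?L\<^esub>B) = \<Squnion>\<^bsub>?L\<^esub>((\<lambda>b. a \<sqinter>\<^bsub>?L\<^esub> b) ` B)"
      using a B B' by (simp add: s m openin_Union)
  qed
qed

end

theory Submission
  imports Defs
begin

text \<open>
  A cartesian lift \<open>(A, \<theta>)\<close> that defines an object of opens of \<open>X\<close> always identifies the frame
  \<open>\<O>(A)\<close> with the frame of open sets of \<open>X\<close>: since the identity of \<open>A\<close> lifts, every point of \<open>X\<close>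
  yields an arrow from \<open>A\<close> into the object \<open>\<two>\<close>, hence a frame homomorphism out of \<open>\<O>(A)\<close>, and the
  points of \<open>X\<close> jointly detect joins and finite meets of open sets (\<open>lifted_open_iso\<close>).  This applies
  to the given category and to its two full subcategories alike.

  For part (1), the left adjoint of \<open>\<O>\<close> with invertible unit provides a fiber-initial object over
  each frame, and every frame homomorphism out of \<open>\<O>(A)\<close> lifts when \<open>A\<close> is fiber-initial
  (\<open>fiber_initial_lifts\<close>).  So on fiber-initial objects \<open>\<O>\<close> is an equivalence with the category of
  frames; all spaces have a cartesian lift there (\<open>Top_I_eq\<close>), the space of points of \<open>A\<close> is the
  space of points of the frame \<open>\<O>(A)\<close> (\<open>pt_fiber_initial_homeomorphic\<close>), and being fixed is
  sobriety.

  For part (2), let \<open>X\<close> be fixed with respect to fiber-terminal objects, with lift \<open>A\<close>, and suppose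
  that \<open>{x}\<close> is not the intersection of an open and a closed set.  Then deleting \<open>x\<close> does not change
  the frame of open sets (\<open>frame_iso_delete_point\<close>), so the lift \<open>B\<close> of \<open>Y = X - {x}\<close> in the whole
  category lies in the fiber of \<open>\<O>(A)\<close>, and fiber-terminality gives an arrow \<open>B \<rightarrow> A\<close>.  Composed with
  the arrow \<open>A \<rightarrow> \<two>\<close> of the point \<open>x\<close>, it is an arrow \<open>B \<rightarrow> \<two>\<close>.  The space \<open>Y\<close> is \<open>T\<^sub>0\<close> and hence
  fixed, so this arrow comes from a point \<open>y\<close> of \<open>Y\<close>.  Then \<open>x\<close> and \<open>y\<close> lie in the same open sets of
  the \<open>T\<^sub>0\<close> space \<open>X\<close>, although \<open>y \<noteq> x\<close>.
\<close>

section \<open>Frame homomorphisms\<close>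

lemma frame_closed:
  assumes "frame L"
  shows "A \<subseteq> carrier L \<Longrightarrow> \<Squnion>\<^bsub>L\<^esub>A \<in> carrier L"
    and "a \<in> carrier L \<Longrightarrow> b \<in> carrier L \<Longrightarrow> a \<sqinter>\<^bsub>L\<^esub> b \<in> carrier L"
    and "\<top>\<^bsub>L\<^esub> \<in> carrier L"
proof -
  interpret frame L by fact
  show "A \<subseteq> carrier L \<Longrightarrow> \<Squnion>\<^bsub>L\<^esub>A \<in> carrier L" by (rule sup_closed)
  show "a \<in> carrier L \<Longrightarrow> b \<in> carrier L \<Longrightarrow> a \<sqinter>\<^bsub>L\<^esub> b \<in> carrier L" by (rule meet_closed)
  show "\<top>\<^bsub>L\<^esub> \<in> carrier L" by (rule top_closed)
qed

lemma frame_hom_extensional: "f \<in> frame_hom L M \<Longrightarrow> f \<in> carrier L \<rightarrow>\<^sub>E carrier M"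
  by (simp add: frame_hom_def)

lemma frame_homI:
  assumes "f \<in> carrier L \<rightarrow>\<^sub>E carrier M"
    and "\<And>A. A \<subseteq> carrier L \<Longrightarrow> f (\<Squnion>\<^bsub>L\<^esub> A) = \<Squnion>\<^bsub>M\<^esub> (f ` A)"
    and "\<And>a b. a \<in> carrier L \<Longrightarrow> b \<in> carrier L \<Longrightarrow> f (a \<sqinter>\<^bsub>L\<^esub> b) = f a \<sqinter>\<^bsub>M\<^esub> f b"
    and "f \<top>\<^bsub>L\<^esub> = \<top>\<^bsub>M\<^esub>"
  shows "f \<in> frame_hom L M"
  using assms by (simp add: frame_hom_def)

lemma frame_hom_compose:
  assumes K: "frame K" and f: "f \<in> frame_hom K L" and g: "g \<in> frame_hom L M"
  shows "compose (carrier K) g f \<in> frame_hom K M"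
proof (rule frame_homI)
  show "compose (carrier K) g f \<in> carrier K \<rightarrow>\<^sub>E carrier M"
    using frame_homD(1)[OF f] frame_homD(1)[OF g] by (auto simp: compose_def)
  fix A assume A: "A \<subseteq> carrier K"
  have "f ` A \<subseteq> carrier L" using A frame_homD(1)[OF f] by blast
  moreover have "compose (carrier K) g f ` A = g ` f ` A"
    using A by (auto simp: compose_def image_image intro!: image_cong)
  ultimately show "compose (carrier K) g f (\<Squnion>\<^bsub>K\<^esub> A) = \<Squnion>\<^bsub>M\<^esub> (compose (carrier K) g f ` A)"
    by (simp add: compose_def frame_closed[OF K] A frame_homD(2)[OF f] frame_homD(2)[OF g])
qed (simp_all add: compose_def frame_closed[OF K] frame_homD[OF f] frame_homD[OF g])

lemma frame_hom_inverse:
  assumes K: "frame K" and L: "frame L" and f: "f \<in> frame_hom K L"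
    and g: "g \<in> carrier L \<rightarrow>\<^sub>E carrier K"
    and gf: "\<And>a. a \<in> carrier K \<Longrightarrow> g (f a) = a" and fg: "\<And>b. b \<in> carrier L \<Longrightarrow> f (g b) = b"
  shows "g \<in> frame_hom L K"
proof (rule frame_homI[OF g])
  have gc: "g b \<in> carrier K" if "b \<in> carrier L" for b using g that by auto
  fix A assume A: "A \<subseteq> carrier L"
  have gA: "g ` A \<subseteq> carrier K" using A gc by blast
  have "f ` g ` A = A" using A fg by force
  then have "f (\<Squnion>\<^bsub>K\<^esub> (g ` A)) = \<Squnion>\<^bsub>L\<^esub> A" using frame_homD(2)[OF f gA] by simp
  then show "g (\<Squnion>\<^bsub>L\<^esub> A) = \<Squnion>\<^bsub>K\<^esub> (g ` A)" using gf[OF frame_closed(1)[OF K gA]] by simp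
next
  have gc: "g b \<in> carrier K" if "b \<in> carrier L" for b using g that by auto
  fix a b assume ab: "a \<in> carrier L" "b \<in> carrier L"
  then have "f (g a \<sqinter>\<^bsub>K\<^esub> g b) = a \<sqinter>\<^bsub>L\<^esub> b" using frame_homD(3)[OF f] gc fg by simp
  then show "g (a \<sqinter>\<^bsub>L\<^esub> b) = g a \<sqinter>\<^bsub>K\<^esub> g b" using gf frame_closed(2)[OF K] gc ab by metis
next
  show "g \<top>\<^bsub>L\<^esub> = \<top>\<^bsub>K\<^esub>" using frame_homD(4)[OF f] gf frame_closed(3)[OF K] by metis
qed

lemma frame_iso_if_bij:
  assumes K: "frame K" and L: "frame L" and f: "f \<in> frame_hom K L"
    and bij: "bij_betw f (carrier K) (carrier L)"
  shows "frame_iso K L f"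
proof -
  define g where "g = (\<lambda>b\<in>carrier L. inv_into (carrier K) f b)"
  have gc: "g \<in> carrier L \<rightarrow>\<^sub>E carrier K"
    using bij_betw_inv_into[OF bij] by (auto simp: g_def bij_betw_def)
  have gf: "g (f a) = a" if "a \<in> carrier K" for a
    using that frame_homD(1)[OF f] bij_betw_inv_into_left[OF bij] by (simp add: g_def)
  have fg: "f (g b) = b" if "b \<in> carrier L" for b
    using that bij_betw_inv_into_right[OF bij] by (simp add: g_def)
  have "g \<in> frame_hom L K" by (rule frame_hom_inverse[OF K L f gc gf fg])
  moreover have "compose (carrier K) g f = frame_id K" "compose (carrier L) f g = frame_id L"
    using gf fg by (auto simp: compose_def)
  ultimately show ?thesis using f by (auto simp: frame_iso_def)
qed

lemma frame_iso_inverseE: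
  assumes "frame_iso K L f"
  obtains g where "frame_iso L K g" "\<And>a. a \<in> carrier K \<Longrightarrow> g (f a) = a"
    "\<And>b. b \<in> carrier L \<Longrightarrow> f (g b) = b"
proof -
  from assms obtain g where g: "f \<in> frame_hom K L" "g \<in> frame_hom L K"
    "compose (carrier K) g f = frame_id K" "compose (carrier L) f g = frame_id L"
    by (auto simp: frame_iso_def)
  show thesis
  proof (rule that)
    show "frame_iso L K g" using g by (auto simp: frame_iso_def)
    show "g (f a) = a" if "a \<in> carrier K" for a
      using fun_cong[OF g(3), of a] that by (simp add: compose_def)
    show "f (g b) = b" if "b \<in> carrier L" for b
      using fun_cong[OF g(4), of b] that by (simp add: compose_def)
  qed
qed

lemma frame_iso_hom: "frame_iso K L f \<Longrightarrow> f \<in> frame_hom K L"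
  by (simp add: frame_iso_def)

lemma frame_iso_bij:
  assumes f: "frame_iso K L f"
  shows "bij_betw f (carrier K) (carrier L)"
proof -
  from f obtain g where g: "frame_iso L K g" "\<And>a. a \<in> carrier K \<Longrightarrow> g (f a) = a"
    "\<And>b. b \<in> carrier L \<Longrightarrow> f (g b) = b"
    by (rule frame_iso_inverseE) blast
  show ?thesis
    using frame_homD(1)[OF frame_iso_hom[OF f]] frame_homD(1)[OF frame_iso_hom[OF g(1)]] g(2,3)
    by (intro bij_betwI[where g = g]) auto
qed

lemma frame_iso_compose:
  assumes "frame K" "frame L" "frame M" "frame_iso K L f" "frame_iso L M g"
  shows "frame_iso K M (compose (carrier K) g f)"
proof (rule frame_iso_if_bij)
  show "compose (carrier K) g f \<in> frame_hom K M"
    using assms by (blast intro: frame_hom_compose frame_iso_hom)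
  show "bij_betw (compose (carrier K) g f) (carrier K) (carrier M)"
    using bij_betw_trans[OF frame_iso_bij[OF assms(4)] frame_iso_bij[OF assms(5)]]
    by (rule bij_betw_cong[THEN iffD1, rotated]) (simp add: compose_def)
qed (use assms in auto)


section \<open>The frame of open sets\<close>

lemma frame_of_opens_simps:
  "carrier (frame_of_opens X) = {U. openin X U}"
  "A \<subseteq> {U. openin X U} \<Longrightarrow> \<Squnion>\<^bsub>frame_of_opens X\<^esub>A = \<Union>A"
  "openin X U \<Longrightarrow> openin X V \<Longrightarrow> U \<sqinter>\<^bsub>frame_of_opens X\<^esub> V = U \<inter> V"
  "\<top>\<^bsub>frame_of_opens X\<^esub> = topspace X"
proof -
  let ?L = "frame_of_opens X"
  have c: "carrier ?L = {U. openin X U}" and l: "le ?L = (\<subseteq>)" by (auto simp: frame_of_opens_def)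
  interpret L: frame ?L by (rule frame_opens)
  show "carrier ?L = {U. openin X U}" by (rule c)
  show "\<Squnion>\<^bsub>?L\<^esub>A = \<Union>A" if "A \<subseteq> {U. openin X U}"
    using L.sup_upper[of A] L.sup_least[of A "\<Union>A"] that unfolding l c by blast
  show "U \<sqinter>\<^bsub>?L\<^esub> V = U \<inter> V" if "openin X U" "openin X V"
    using L.meet_left[of U V] L.meet_right[of U V] L.meet_le[of "U \<inter> V" U V] that
    unfolding l c by blast
  show "\<top>\<^bsub>?L\<^esub> = topspace X"
    using L.top_higher[of "topspace X"] L.top_closed unfolding l c
    by (auto dest: openin_subset)
qed

text \<open>The points of a space jointly detect the frame homomorphisms into its frame of open sets.\<close>

lemma frame_hom_opens_iff:
  assumes L: "frame L" and k: "k \<in> carrier L \<rightarrow>\<^sub>E carrier (frame_of_opens X)"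
  shows "k \<in> frame_hom L (frame_of_opens X) \<longleftrightarrow>
    (\<forall>x\<in>topspace X. (\<lambda>a\<in>carrier L. x \<in> k a) \<in> frame_hom L two_frame)" (is "?l \<longleftrightarrow> ?r")
proof
  have ko: "openin X (k a)" if "a \<in> carrier L" for a
    using k that by (auto simp: frame_of_opens_simps)
  have kA: "k ` A \<subseteq> {U. openin X U}" if "A \<subseteq> carrier L" for A using ko that by auto
  { assume h: ?l
    show ?r
    proof (intro ballI frame_homI)
      fix x assume x: "x \<in> topspace X"
      show "(\<lambda>a\<in>carrier L. x \<in> k a) \<in> carrier L \<rightarrow>\<^sub>E carrier two_frame"
        by (simp add: two_simps)
      show "(\<lambda>a\<in>carrier L. x \<in> k a) (\<Squnion>\<^bsub>L\<^esub> A) =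
          \<Squnion>\<^bsub>two_frame\<^esub> ((\<lambda>a\<in>carrier L. x \<in> k a) ` A)" if "A \<subseteq> carrier L" for A
      proof -
        have "(\<lambda>a\<in>carrier L. x \<in> k a) ` A = (\<lambda>a. x \<in> k a) ` A"
          using that by (intro image_cong) auto
        then show ?thesis
          using frame_homD(2)[OF h that] frame_of_opens_simps(2)[OF kA[OF that]]
          by (simp add: frame_closed(1)[OF L that] two_simps)
      qed
      show "(\<lambda>a\<in>carrier L. x \<in> k a) \<top>\<^bsub>L\<^esub> = \<top>\<^bsub>two_frame\<^esub>"
        using x by (simp add: frame_closed[OF L] two_simps frame_homD(4)[OF h] frame_of_opens_simps)
    qed (simp add: frame_closed[OF L] two_simps frame_homD(3)[OF h] frame_of_opens_simps ko)
  }
  { assume r: ?r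
    have sub: "k a \<subseteq> topspace X" if "a \<in> carrier L" for a
      using ko[OF that] by (rule openin_subset)
    show ?l
    proof (rule frame_homI[OF k])
      fix A assume A: "A \<subseteq> carrier L"
      have "x \<in> k (\<Squnion>\<^bsub>L\<^esub> A) \<longleftrightarrow> x \<in> \<Union>(k ` A)" for x
      proof (cases "x \<in> topspace X")
        case True
        have "(\<lambda>a\<in>carrier L. x \<in> k a) ` A = (\<lambda>a. x \<in> k a) ` A"
          using A by (intro image_cong) auto
        with frame_homD(2)[OF bspec[OF r True] A] show ?thesis
          by (simp add: frame_closed(1)[OF L A] two_simps)
      qed (use sub A frame_closed(1)[OF L A] in blast)
      then show "k (\<Squnion>\<^bsub>L\<^esub> A) = \<Squnion>\<^bsub>frame_of_opens X\<^esub> (k ` A)"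
        using frame_of_opens_simps(2)[OF kA[OF A]] by blast
    next
      fix a b assume ab: "a \<in> carrier L" "b \<in> carrier L"
      have "x \<in> k (a \<sqinter>\<^bsub>L\<^esub> b) \<longleftrightarrow> x \<in> k a \<inter> k b" for x
      proof (cases "x \<in> topspace X")
        case True
        from frame_homD(3)[OF bspec[OF r True] ab] ab show ?thesis
          by (simp add: frame_closed[OF L] two_simps)
      qed (use sub ab frame_closed(2)[OF L ab] in blast)
      then show "k (a \<sqinter>\<^bsub>L\<^esub> b) = k a \<sqinter>\<^bsub>frame_of_opens X\<^esub> k b"
        using frame_of_opens_simps(3)[OF ko[OF ab(1)] ko[OF ab(2)]] by blast
    next
      have "x \<in> k \<top>\<^bsub>L\<^esub>" if "x \<in> topspace X" for x
        using frame_homD(4)[OF bspec[OF r that]] by (simp add: frame_closed[OF L] two_simps)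
      then show "k \<top>\<^bsub>L\<^esub> = \<top>\<^bsub>frame_of_opens X\<^esub>"
        using sub[OF frame_closed(3)[OF L]] by (auto simp: frame_of_opens_simps)
    qed }
qed

text \<open>
  Over the universe, a small space has a small lattice of open sets; an isomorphic copy of this
  frame is carried by a member of the universe.
\<close>

lemma (in universe) small_frame_of_opens:
  fixes X :: "'u topology"
  assumes "X \<in> Top \<U>"
  obtains L g where "L \<in> Ob (Frm \<U>)" "frame_iso L (frame_of_opens X) g"
proof -
  have "topspace X \<in> \<U>" using assms by (simp add: Top_def small_iff)
  then obtain B f where B: "B \<in> \<U>" and f: "bij_betw f (Pow (topspace X)) B"
    using Pow_small by (meson eqpoll_def)
  let ?O = "{U. openin X U}"
  define C where "C = f ` ?O"
  have sub: "?O \<subseteq> Pow (topspace X)" by (auto dest: openin_subset)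
  have CU: "C \<in> \<U>"
    using B sub f by (intro subset_small[of B C]) (auto simp: C_def bij_betw_def)
  have inj: "inj_on f ?O" using f sub by (auto simp: bij_betw_def intro: inj_on_subset)
  define g where "g = (\<lambda>c\<in>C. inv_into ?O f c)"
  have bij: "bij_betw g C ?O"
    using bij_betw_inv_into[OF inj_on_imp_bij_betw[OF inj]]
    unfolding C_def[symmetric] by (rule bij_betw_cong[THEN iffD1, rotated]) (simp add: g_def)
  define L :: "'u gorder" where "L = \<lparr>carrier = C, eq = (=), le = (\<lambda>a b. g a \<subseteq> g b)\<rparr>"
  have c: "carrier L = C" and l: "le L = (\<lambda>a b. g a \<subseteq> g b)" by (simp_all add: L_def)
  have go: "openin X (g a)" if "a \<in> C" for a using bij that by (auto simp: bij_betw_def)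
  have gi: "a = b" if "g a = g b" "a \<in> C" "b \<in> C" for a b
    using that bij by (auto simp: bij_betw_def inj_on_def)
  have gs: "\<exists>a\<in>C. g a = U" if "openin X U" for U
  proof -
    have "U \<in> g ` C" using bij that by (simp add: bij_betw_def)
    then show ?thesis by blast
  qed
  \<comment> \<open>The order of \<open>L\<close> is transported along the bijection \<open>g\<close>, and with it the lattice structure.\<close>
  interpret L: Complete_Lattice.complete_lattice L
  proof
    fix A assume A: "A \<subseteq> carrier L"
    have "openin X (\<Union>(g ` A))" using A go by (auto simp: c)
    then obtain s where "s \<in> C" "g s = \<Union>(g ` A)" using gs by blast
    then show "\<exists>s. least L s (Upper L A)"
      using A by (intro exI[of _ s]) (auto simp: least_def Upper_def c l)
    have "openin X (\<Union>{U. openin X U \<and> (\<forall>a\<in>A. U \<subseteq> g a)})" by auto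
    then obtain i where i: "i \<in> C" "g i = \<Union>{U. openin X U \<and> (\<forall>a\<in>A. U \<subseteq> g a)}" using gs by blast
    have "g b \<subseteq> g i" if "b \<in> C" "\<forall>a\<in>A. g b \<subseteq> g a" for b
      using go[OF that(1)] that(2) unfolding i(2) by blast
    moreover have "g i \<subseteq> g a" if "a \<in> A" for a
      using that unfolding i(2) by blast
    ultimately show "\<exists>s. greatest L s (Lower L A)"
      using A i(1) unfolding greatest_def Lower_def c l by blast
  qed (use gi in \<open>auto simp: L_def\<close>)
  have s: "g (\<Squnion>\<^bsub>L\<^esub> A) = \<Union>(g ` A)" if A: "A \<subseteq> C" for A
  proof -
    have "openin X (\<Union>(g ` A))" using A go by auto
    then obtain s where "s \<in> C" "g s = \<Union>(g ` A)" using gs by blast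
    then show ?thesis
      using L.sup_upper[of A] L.sup_least[of A s] A unfolding l c by blast
  qed
  have m: "g (a \<sqinter>\<^bsub>L\<^esub> b) = g a \<inter> g b" if ab: "a \<in> C" "b \<in> C" for a b
  proof -
    have "openin X (g a \<inter> g b)" using ab go by auto
    then obtain i where "i \<in> C" "g i = g a \<inter> g b" using gs by blast
    then show ?thesis
      using L.meet_left[of a b] L.meet_right[of a b] L.meet_le[of i a b] ab unfolding l c by blast
  qed
  have t: "g \<top>\<^bsub>L\<^esub> = topspace X"
  proof -
    obtain i where "i \<in> C" "g i = topspace X" using gs by blast
    then show ?thesis
      using L.top_higher[of i] L.top_closed go openin_subset unfolding l c by blast
  qed
  have fr: "frame L"
  proof
    fix a A assume a: "a \<in> carrier L" and A: "A \<subseteq> carrier L"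
    have aA: "(\<lambda>b. a \<sqinter>\<^bsub>L\<^esub> b) ` A \<subseteq> C" using a A L.meet_closed unfolding c by blast
    have "g (a \<sqinter>\<^bsub>L\<^esub> (\<Squnion>\<^bsub>L\<^esub>A)) = g (\<Squnion>\<^bsub>L\<^esub>((\<lambda>b. a \<sqinter>\<^bsub>L\<^esub> b) ` A))"
      using a A L.sup_closed[OF A] s[OF aA] unfolding c by (auto simp: m s subset_iff)
    then show "a \<sqinter>\<^bsub>L\<^esub> (\<Squnion>\<^bsub>L\<^esub>A) = \<Squnion>\<^bsub>L\<^esub>((\<lambda>b. a \<sqinter>\<^bsub>L\<^esub> b) ` A)"
      using gi a A aA L.sup_closed L.meet_closed unfolding c by meson
  qed
  have "g \<in> frame_hom L (frame_of_opens X)"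
  proof (rule frame_homI)
    show "g \<in> carrier L \<rightarrow>\<^sub>E carrier (frame_of_opens X)"
      using go by (auto simp: c frame_of_opens_simps g_def)
    show "g (\<Squnion>\<^bsub>L\<^esub> A) = \<Squnion>\<^bsub>frame_of_opens X\<^esub> (g ` A)" if A: "A \<subseteq> carrier L" for A
    proof -
      have "g ` A \<subseteq> {U. openin X U}" using A go by (auto simp: c)
      then show ?thesis using A by (simp add: frame_of_opens_simps s c)
    qed
  qed (simp_all add: c m t go frame_of_opens_simps)
  then have "frame_iso L (frame_of_opens X) g"
    using bij by (intro frame_iso_if_bij fr frame_opens) (simp_all add: c frame_of_opens_simps)
  moreover have "L \<in> Ob (Frm \<U>)" using fr CU by (simp add: Frm_def c small_iff)
  ultimately show thesis by (rule that[rotated])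
qed

text \<open>
  Deleting a point that is not locally closed does not change the frame of open sets: two open
  sets that differ exactly by the point would exhibit it as the intersection of an open and a
  closed set.
\<close>

lemma frame_iso_delete_point:
  assumes x: "x \<in> topspace X" and no: "\<nexists>U C. openin X U \<and> closedin X C \<and> {x} = U \<inter> C"
  defines "Y \<equiv> subtopology X (topspace X - {x})"
  shows "frame_iso (frame_of_opens X) (frame_of_opens Y) (\<lambda>U\<in>carrier (frame_of_opens X). U - {x})"
    (is "frame_iso ?X ?Y ?r")
proof (rule frame_iso_if_bij[OF frame_opens frame_opens])
  have opY: "openin Y V \<longleftrightarrow> (\<exists>U. openin X U \<and> V = U - {x})" for V
  proof -
    have "U \<inter> (topspace X - {x}) = U - {x}" if "openin X U" for U
      using openin_subset[OF that] by blast
    then show ?thesis unfolding Y_def openin_subtopology by metis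
  qed
  have rE: "?r \<in> carrier ?X \<rightarrow>\<^sub>E carrier ?Y"
    by (auto simp: frame_of_opens_simps opY)
  have top: "topspace Y = topspace X - {x}" by (auto simp: Y_def)
  show "?r \<in> frame_hom ?X ?Y"
    unfolding frame_hom_opens_iff[OF frame_opens rE]
  proof
    fix y assume y: "y \<in> topspace Y"
    \<comment> \<open>At points other than \<open>x\<close>, membership in \<open>U - {x}\<close> is membership in \<open>U\<close>.\<close>
    have id: "(\<lambda>U\<in>carrier ?X. U) \<in> frame_hom ?X ?X"
    proof (rule frame_homI)
      show "(\<lambda>U\<in>carrier ?X. U) (\<Squnion>\<^bsub>?X\<^esub> A) = \<Squnion>\<^bsub>?X\<^esub> ((\<lambda>U\<in>carrier ?X. U) ` A)"
        if A: "A \<subseteq> carrier ?X" for A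
      proof -
        have "(\<lambda>U\<in>carrier ?X. U) ` A = A" using A by force
        then show ?thesis using frame_closed(1)[OF frame_opens A] by simp
      qed
    qed (use frame_closed(2,3)[OF frame_opens[of X]] in auto)
    have "y \<in> topspace X" using y top by auto
    with id have "(\<lambda>a\<in>carrier ?X. y \<in> (\<lambda>U\<in>carrier ?X. U) a) \<in> frame_hom ?X two_frame"
      unfolding frame_hom_opens_iff[OF frame_opens frame_hom_extensional[OF id]] by blast
    moreover have "(\<lambda>a\<in>carrier ?X. y \<in> (\<lambda>U\<in>carrier ?X. U) a) = (\<lambda>a\<in>carrier ?X. y \<in> ?r a)"
      using y top by (auto simp: fun_eq_iff)
    ultimately show "(\<lambda>a\<in>carrier ?X. y \<in> ?r a) \<in> frame_hom ?X two_frame" by simp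
  qed
  have *: "x \<in> V" if UV: "openin X U" "openin X V" "U - {x} = V - {x}" "x \<in> U" for U V
  proof (rule ccontr)
    assume "x \<notin> V"
    then have "{x} = U \<inter> (topspace X - V)" using UV x by auto
    moreover have "closedin X (topspace X - V)" using UV by blast
    ultimately show False using no UV(1) by blast
  qed
  have "U = V" if UV: "openin X U" "openin X V" "U - {x} = V - {x}" for U V
    using *[of U V] *[of V U] UV by blast
  then have "inj_on ?r (carrier ?X)" by (auto simp: inj_on_def frame_of_opens_simps)
  moreover have "?r ` carrier ?X = carrier ?Y"
    by (auto simp: frame_of_opens_simps opY)
  ultimately show "bij_betw ?r (carrier ?X) (carrier ?Y)" by (simp add: bij_betw_def)
qed


section \<open>Lifted open sets and points\<close>

lemma Top_hom_sierpinski_bij: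
  "bij_betw (\<lambda>U. \<lambda>x\<in>topspace X. x \<in> U) {U. openin X U} (Top_hom X sierpinski)"
proof (rule bij_betwI[where g = "\<lambda>f. {x \<in> topspace X. f x}"])
  have ts: "topspace sierpinski = UNIV"
    unfolding topspace_def openin_sierpinski by auto
  show "(\<lambda>U. \<lambda>x\<in>topspace X. x \<in> U) \<in> {U. openin X U} \<rightarrow> Top_hom X sierpinski"
  proof
    fix U assume "U \<in> {U. openin X U}"
    then have U: "openin X U" "U \<subseteq> topspace X" by (auto dest: openin_subset)
    have "openin X {x \<in> topspace X. (\<lambda>x\<in>topspace X. x \<in> U) x \<in> V}"
      if V: "openin sierpinski V" for V
    proof -
      have "{x \<in> topspace X. (\<lambda>x\<in>topspace X. x \<in> U) x \<in> V} \<in> {{}, U, topspace X}"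
        using V U(2) unfolding openin_sierpinski by (elim insertE) auto
      then show ?thesis using U(1) by (elim insertE emptyE) simp_all
    qed
    then have "continuous_map X sierpinski (\<lambda>x\<in>topspace X. x \<in> U)"
      by (simp add: continuous_map_def ts)
    then show "(\<lambda>x\<in>topspace X. x \<in> U) \<in> Top_hom X sierpinski" by (simp add: Top_hom_def ts)
  qed
  show "(\<lambda>f. {x \<in> topspace X. f x}) \<in> Top_hom X sierpinski \<rightarrow> {U. openin X U}"
  proof
    fix f assume "f \<in> Top_hom X sierpinski"
    then have "openin X {x \<in> topspace X. f x \<in> {True}}"
      unfolding Top_hom_def by (intro openin_continuous_map_preimage) (auto simp: openin_sierpinski)
    then show "{x \<in> topspace X. f x} \<in> {U. openin X U}" by simp
  qed
  show "{x \<in> topspace X. (\<lambda>x\<in>topspace X. x \<in> U) x} = U" if "U \<in> {U. openin X U}" for U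
    using that by (auto dest: openin_subset)
  show "(\<lambda>x\<in>topspace X. x \<in> {x \<in> topspace X. f x}) = f" if "f \<in> Top_hom X sierpinski" for f
    using that by (auto simp: Top_hom_def fun_eq_iff PiE_def extensional_def)
qed

text \<open>
  The open set represented by an element of a cartesian lift \<open>(A, \<theta>)\<close>, whose second component
  identifies the elements of \<open>\<O>(A)\<close> with continuous maps into the Sierpinski space.
\<close>

definition lifted_open :: "('o, 'm, 'u) pfc \<Rightarrow> 'x topology \<Rightarrow> 'o \<Rightarrow> ('u \<Rightarrow> 'x \<Rightarrow> bool) \<Rightarrow> 'u \<Rightarrow> 'x set"
  where "lifted_open P X A \<theta> = (\<lambda>a\<in>O_set P A. {x \<in> topspace X. \<theta> a x})"

context pfc_category
begin

lemma frame_O: "A \<in> Ob (cat P) \<Longrightarrow> frame (O_ob P A)"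
  and O_small: "A \<in> Ob (cat P) \<Longrightarrow> O_ob P A \<in> Ob (Frm \<U>)"
  using O_functor by (auto simp: is_functor_def Frm_def)

lemma O_arr_hom:
  "A \<in> Ob (cat P) \<Longrightarrow> B \<in> Ob (cat P) \<Longrightarrow> p \<in> Hom (cat P) A B \<Longrightarrow>
    O_arr P A B p \<in> frame_hom (O_ob P A) (O_ob P B)"
  using O_functor by (auto simp: is_functor_def Frm_def)

lemma O_arr_Ide: "A \<in> Ob (cat P) \<Longrightarrow> O_arr P A A (Ide (cat P) A) = frame_id (O_ob P A)"
  using O_functor by (auto simp: is_functor_def Frm_def)

lemma O_arr_Comp:
  "A \<in> Ob (cat P) \<Longrightarrow> B \<in> Ob (cat P) \<Longrightarrow> C \<in> Ob (cat P) \<Longrightarrow>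
    p \<in> Hom (cat P) A B \<Longrightarrow> q \<in> Hom (cat P) B C \<Longrightarrow>
    O_arr P A C (Comp (cat P) A B C q p) = compose (O_set P A) (O_arr P B C q) (O_arr P A B p)"
  using O_functor by (auto simp: is_functor_def Frm_def)

lemma Ide_in: "A \<in> Ob (cat P) \<Longrightarrow> Ide (cat P) A \<in> Hom (cat P) A A"
  using is_category by (auto simp: is_category_def)

lemma Comp_in:
  "A \<in> Ob (cat P) \<Longrightarrow> B \<in> Ob (cat P) \<Longrightarrow> C \<in> Ob (cat P) \<Longrightarrow>
    p \<in> Hom (cat P) A B \<Longrightarrow> q \<in> Hom (cat P) B C \<Longrightarrow> Comp (cat P) A B C q p \<in> Hom (cat P) A C"
  using is_category unfolding is_category_def by blast

lemma O_arr_inject: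
  "A \<in> Ob (cat P) \<Longrightarrow> B \<in> Ob (cat P) \<Longrightarrow> p \<in> Hom (cat P) A B \<Longrightarrow> q \<in> Hom (cat P) A B \<Longrightarrow>
    O_arr P A B p = O_arr P A B q \<Longrightarrow> p = q"
  using O_faithful by (auto simp: is_faithful_def inj_on_def)

lemma lifts_frame_hom:
  "lifts P A B h \<Longrightarrow> A \<in> Ob (cat P) \<Longrightarrow> B \<in> Ob (cat P) \<Longrightarrow> h \<in> frame_hom (O_ob P A) (O_ob P B)"
  by (auto simp: lifts_def O_arr_hom)

lemma lift_of_eq:
  assumes "lifts P A B h" "A \<in> Ob (cat P)" "B \<in> Ob (cat P)"
  shows "lift_of P A B h \<in> Hom (cat P) A B" "O_arr P A B (lift_of P A B h) = h"
proof -
  have "\<exists>!p. p \<in> Hom (cat P) A B \<and> O_arr P A B p = h"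
    using assms O_arr_inject unfolding lifts_def by blast
  from theI'[OF this] show "lift_of P A B h \<in> Hom (cat P) A B" "O_arr P A B (lift_of P A B h) = h"
    by (auto simp: lift_of_def)
qed

abbreviation (input) iota_inv :: "bool \<Rightarrow> 'u" where
  "iota_inv \<equiv> inv_into (O_set P (two_ob P)) (iota P)"

lemma iota_inv:
  "iota P (iota_inv b) = b" "iota_inv b \<in> O_set P (two_ob P)"
  "c \<in> O_set P (two_ob P) \<Longrightarrow> iota_inv (iota P c) = c"
proof -
  note bij = frame_iso_bij[OF iota_iso]
  have b: "b \<in> carrier two_frame" by (simp add: two_simps)
  show "iota P (iota_inv b) = b" by (rule bij_betw_inv_into_right[OF bij b])
  show "iota_inv b \<in> O_set P (two_ob P)"
    using bij_betw_inv_into[OF bij] b by (auto simp: bij_betw_def)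
  show "c \<in> O_set P (two_ob P) \<Longrightarrow> iota_inv (iota P c) = c" by (rule bij_betw_inv_into_left[OF bij])
qed

text \<open>
  Frame homomorphisms into \<open>\<O>(\<two>)\<close> correspond to frame homomorphisms into \<open>two_frame\<close> along \<open>\<iota>\<close>.
\<close>

lemma frame_hom_two_iff:
  assumes L: "frame L"
  shows "(\<lambda>a\<in>carrier L. iota_inv (k a)) \<in> frame_hom L (O_ob P (two_ob P)) \<longleftrightarrow>
    (\<lambda>a\<in>carrier L. k a) \<in> frame_hom L two_frame"
proof
  assume "(\<lambda>a\<in>carrier L. iota_inv (k a)) \<in> frame_hom L (O_ob P (two_ob P))"
  from frame_hom_compose[OF L this frame_iso_hom[OF iota_iso]]
  show "(\<lambda>a\<in>carrier L. k a) \<in> frame_hom L two_frame"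
    by (simp add: compose_def iota_inv cong: restrict_cong)
next
  assume k: "(\<lambda>a\<in>carrier L. k a) \<in> frame_hom L two_frame"
  from frame_iso_inverseE[OF iota_iso] obtain j where
    j: "frame_iso two_frame (O_ob P (two_ob P)) j" "\<And>a. a \<in> O_set P (two_ob P) \<Longrightarrow> j (iota P a) = a"
    by metis
  have "j b = iota_inv b" for b using j(2)[OF iota_inv(2)[of b]] by (simp add: iota_inv)
  with frame_hom_compose[OF L k frame_iso_hom[OF j(1)]]
  show "(\<lambda>a\<in>carrier L. iota_inv (k a)) \<in> frame_hom L (O_ob P (two_ob P))"
    by (simp add: compose_def cong: restrict_cong)
qed

lemma topspace_pt\<^sub>C:
  assumes A: "A \<in> Ob (cat P)"
  shows "topspace (pt\<^sub>C P A) = Hom (cat P) A (two_ob P)"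
proof -
  have "f \<in> topspace (pt\<^sub>C P A)" if f: "f \<in> Hom (cat P) A (two_ob P)" for f
  proof -
    have "iota P (O_arr P A (two_ob P) f \<top>\<^bsub>O_ob P A\<^esub>)"
      using frame_homD(4)[OF O_arr_hom[OF A two_ob f]] frame_homD(4)[OF frame_iso_hom[OF iota_iso]]
      by (simp add: two_simps)
    then show ?thesis
      unfolding topspace_def using f openin_pt\<^sub>C[OF A] frame_closed(3)[OF frame_O[OF A]] by blast
  qed
  then show ?thesis
    unfolding topspace_def using openin_pt\<^sub>C[OF A] by blast
qed

context
  fixes X :: "'x topology" and A \<theta>
  assumes Om: "is_Omega P X A \<theta>"
begin

lemma Omega_Ob: "A \<in> Ob (cat P)"
  using Om by (simp add: is_Omega_def cartesian_lift_def)

lemma Omega_theta: "a \<in> O_set P A \<Longrightarrow> \<theta> a \<in> Top_hom X sierpinski"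
proof -
  assume a: "a \<in> O_set P A"
  have "\<theta> \<in> O_set P A \<rightarrow>\<^sub>E Top_hom X sierpinski"
    using Om by (simp add: is_Omega_def cartesian_lift_def)
  from PiE_mem[OF this a] show ?thesis .
qed

text \<open>Every point lifts: apply the defining property of a cartesian lift to the identity.\<close>

lemma Omega_point_lifts:
  assumes x: "x \<in> topspace X"
  shows "lifts P A (two_ob P) (\<lambda>a\<in>O_set P A. chi P X x (\<theta> a))"
proof -
  have "lifts P A A (frame_id (O_ob P A))"
    using Ide_in[OF Omega_Ob] O_arr_Ide[OF Omega_Ob] by (auto simp: lifts_def)
  moreover have "frame_id (O_ob P A) \<in> O_set P A \<rightarrow>\<^sub>E O_set P A" by simp
  ultimately have "\<forall>f\<in>chi P X ` topspace X.
      lifts P A (two_ob P) (\<lambda>a\<in>O_set P A. f (\<theta> (frame_id (O_ob P A) a)))"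
    using Om Omega_Ob unfolding is_Omega_def cartesian_lift_def by blast
  with x show ?thesis by (simp cong: restrict_cong)
qed

lemma chi_theta:
  "x \<in> topspace X \<Longrightarrow> a \<in> O_set P A \<Longrightarrow>
    chi P X x (\<theta> a) = iota_inv (x \<in> lifted_open P X A \<theta> a)"
  by (simp add: chi_def Omega_theta lifted_open_def)

text \<open>
  That the open sets form a frame isomorphic to \<open>\<O>(A)\<close> is not part of the definition of a cartesian
  lift, which only provides a bijection.  The isomorphism holds because all points lift.
\<close>

lemma lifted_open_iso: "frame_iso (O_ob P A) (frame_of_opens X) (lifted_open P X A \<theta>)"
proof (rule frame_iso_if_bij[OF frame_O[OF Omega_Ob] frame_opens])
  let ?e = "\<lambda>U. \<lambda>x\<in>topspace X. x \<in> U"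
  have "bij_betw (inv_into {U. openin X U} ?e \<circ> \<theta>) (O_set P A) {U. openin X U}"
    using Om bij_betw_inv_into[OF Top_hom_sierpinski_bij]
    by (auto simp: is_Omega_def cartesian_lift_def intro: bij_betw_trans)
  moreover have "(inv_into {U. openin X U} ?e \<circ> \<theta>) a = lifted_open P X A \<theta> a"
    if a: "a \<in> O_set P A" for a
  proof -
    from Omega_theta[OF a] obtain U where U: "openin X U" "\<theta> a = ?e U"
      using Top_hom_sierpinski_bij[of X] by (auto simp: bij_betw_def)
    have "inv_into {U. openin X U} ?e (?e U) = U"
      using bij_betw_inv_into_left[OF Top_hom_sierpinski_bij] U(1) by blast
    moreover have "{x \<in> topspace X. ?e U x} = U" using openin_subset[OF U(1)] by auto
    ultimately show ?thesis using U(2) a by (simp add: lifted_open_def)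
  qed
  ultimately show bij: "bij_betw (lifted_open P X A \<theta>) (O_set P A) (carrier (frame_of_opens X))"
    unfolding frame_of_opens_simps by (rule bij_betw_cong[THEN iffD1, rotated])
  then have E: "lifted_open P X A \<theta> \<in> O_set P A \<rightarrow>\<^sub>E carrier (frame_of_opens X)"
    by (auto simp: bij_betw_def lifted_open_def)
  show "lifted_open P X A \<theta> \<in> frame_hom (O_ob P A) (frame_of_opens X)"
    unfolding frame_hom_opens_iff[OF frame_O[OF Omega_Ob] E]
  proof
    fix x assume x: "x \<in> topspace X"
    from lifts_frame_hom[OF Omega_point_lifts[OF x] Omega_Ob two_ob]
    have "(\<lambda>a\<in>O_set P A. iota_inv (x \<in> lifted_open P X A \<theta> a))
        \<in> frame_hom (O_ob P A) (O_ob P (two_ob P))"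
      by (simp add: chi_theta[OF x] cong: restrict_cong)
    then show "(\<lambda>a\<in>O_set P A. x \<in> lifted_open P X A \<theta> a) \<in> frame_hom (O_ob P A) two_frame"
      by (simp only: frame_hom_two_iff[OF frame_O[OF Omega_Ob]])
  qed
qed

end

lemma is_Omega_Omega: "X \<in> Top\<^sub>C \<U> P \<Longrightarrow> is_Omega P X (Omega P X) (theta P X)"
  using someI_ex[of "\<lambda>(A, \<theta>). is_Omega P X A \<theta>"]
  by (auto simp: Top\<^sub>C_def Omega_def theta_def Omega_lift_def case_prod_unfold)

lemma sigma_point:
  assumes X: "X \<in> Top\<^sub>C \<U> P" and x: "x \<in> topspace X"
  shows "sigma P X x \<in> Hom (cat P) (Omega P X) (two_ob P)"
    and "a \<in> O_set P (Omega P X) \<Longrightarrow>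
      iota P (O_arr P (Omega P X) (two_ob P) (sigma P X x) a) \<longleftrightarrow>
      x \<in> lifted_open P X (Omega P X) (theta P X) a"
proof -
  note Om = is_Omega_Omega[OF X]
  note l = lift_of_eq[OF Omega_point_lifts[OF Om x] Omega_Ob[OF Om] two_ob]
  show "sigma P X x \<in> Hom (cat P) (Omega P X) (two_ob P)" using l(1) by (simp add: sigma_def)
  show "iota P (O_arr P (Omega P X) (two_ob P) (sigma P X x) a) \<longleftrightarrow>
      x \<in> lifted_open P X (Omega P X) (theta P X) a" if "a \<in> O_set P (Omega P X)"
    using that by (simp add: sigma_def l(2) chi_theta[OF Om x] iota_inv)
qed

text \<open>
  Fixed spaces are \<open>T\<^sub>0\<close>: the unit only depends on the open sets containing a point.
\<close>

lemma Fix_points_separated: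
  assumes X: "X \<in> Fix \<U> P" and xy: "x \<in> topspace X" "y \<in> topspace X"
    and eq: "\<And>U. openin X U \<Longrightarrow> x \<in> U \<longleftrightarrow> y \<in> U"
  shows "x = y"
proof -
  have "g x = g y" if "g \<in> Top_hom X sierpinski" for g
  proof -
    from that obtain U where "openin X U" "g = (\<lambda>x\<in>topspace X. x \<in> U)"
      using Top_hom_sierpinski_bij[of X] by (auto simp: bij_betw_def)
    then show ?thesis using eq xy by simp
  qed
  then have "chi P X x = chi P X y" unfolding chi_def by (intro restrict_ext arg_cong[where f = iota_inv])
  then have "sigma P X x = sigma P X y" by (simp add: sigma_def)
  moreover have "inj_on (sigma P X) (topspace X)"
    using X by (auto simp: Fix_def dest: homeomorphic_imp_injective_map)
  ultimately show ?thesis using xy by (auto simp: inj_on_def)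
qed

end


section \<open>Full subcategories of fiber-initial and fiber-terminal objects\<close>

lemma pfc_full_subcategory:
  assumes "pfc_category \<U> P" and "S (two_ob P)"
  shows "pfc_category \<U> (P\<lparr>cat := full_subcategory (cat P) S\<rparr>)"
proof -
  interpret pfc_category \<U> P by fact
  show ?thesis
  proof
    show "is_category (cat (P\<lparr>cat := full_subcategory (cat P) S\<rparr>))"
      using is_category by (simp add: is_category_def full_subcategory_def)
    show "is_functor (cat (P\<lparr>cat := full_subcategory (cat P) S\<rparr>)) (Frm \<U>)
        (O_ob (P\<lparr>cat := full_subcategory (cat P) S\<rparr>)) (O_arr (P\<lparr>cat := full_subcategory (cat P) S\<rparr>))"
      using O_functor by (simp add: is_functor_def full_subcategory_def)
    show "is_faithful (cat (P\<lparr>cat := full_subcategory (cat P) S\<rparr>))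
        (O_arr (P\<lparr>cat := full_subcategory (cat P) S\<rparr>))"
      using O_faithful by (simp add: is_faithful_def full_subcategory_def)
  qed (use two_ob iota_iso assms(2) in \<open>simp_all add: full_subcategory_def\<close>)
qed

lemma pfc_I_simps [simp]:
  "A \<in> Ob (cat (pfc_I P)) \<longleftrightarrow> fiber_initial P A" "Hom (cat (pfc_I P)) = Hom (cat P)"
  "O_ob (pfc_I P) = O_ob P" "O_arr (pfc_I P) = O_arr P"
  "two_ob (pfc_I P) = two_ob P" "iota (pfc_I P) = iota P"
  by (auto simp: pfc_I_def full_subcategory_def fiber_initial_def)

lemma pfc_T_simps [simp]:
  "A \<in> Ob (cat (pfc_T P)) \<longleftrightarrow> fiber_terminal P A" "Hom (cat (pfc_T P)) = Hom (cat P)"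
  "O_ob (pfc_T P) = O_ob P" "O_arr (pfc_T P) = O_arr P"
  "two_ob (pfc_T P) = two_ob P" "iota (pfc_T P) = iota P"
  by (auto simp: pfc_T_def full_subcategory_def fiber_terminal_def)


section \<open>Fixed spaces of fiber-terminal objects\<close>

lemma (in total_sfc_category) Fix_T_td_space:
  fixes X :: "'u topology"
  assumes X: "X \<in> Fix \<U> (pfc_T P)"
  shows "td_space X"
  unfolding td_space_def
proof (rule ballI, rule ccontr)
  fix x assume x: "x \<in> topspace X"
    and no: "\<nexists>U C. openin X U \<and> closedin X C \<and> {x} = U \<inter> C"
  interpret T: pfc_category \<U> "pfc_T P"
    unfolding pfc_T_def using pfc_category_axioms T2_two_ob(2) by (rule pfc_full_subcategory)
  define A where "A = Omega (pfc_T P) X"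
  define u where "u = lifted_open (pfc_T P) X A (theta (pfc_T P) X)"
  have XT: "X \<in> Top\<^sub>C \<U> (pfc_T P)" using X by (simp add: Fix_def)
  have u: "frame_iso (O_ob P A) (frame_of_opens X) u"
    using T.lifted_open_iso[OF T.is_Omega_Omega[OF XT]] by (simp add: A_def u_def)
  have At: "fiber_terminal P A"
    using T.Omega_Ob[OF T.is_Omega_Omega[OF XT]] by (simp add: A_def)
  then have A: "A \<in> Ob (cat P)" by (simp add: fiber_terminal_def)
  define Y where "Y = subtopology X (topspace X - {x})"
  have topY: "topspace Y = topspace X - {x}" by (auto simp: Y_def)
  note r = frame_iso_delete_point[OF x no, folded Y_def]
  have "topspace X \<in> \<U>" using XT by (simp add: Top\<^sub>C_def Top_def small_iff)
  then have YTop: "Y \<in> Top \<U>"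
    using subset_small[of "topspace X" "topspace Y"] topY by (auto simp: Top_def small_iff)
  then have YC: "Y \<in> Top\<^sub>C \<U> P" using T1_Top by simp
  have sep: "y = z" if "y \<in> topspace X" "z \<in> topspace X"
    "\<And>U. openin X U \<Longrightarrow> y \<in> U \<longleftrightarrow> z \<in> U" for y z
    using T.Fix_points_separated[OF X] that by blast
  have "t0_space Y"
    unfolding t0_space_def
  proof (intro ballI impI)
    fix y z assume yz: "y \<in> topspace Y" "z \<in> topspace Y" "y \<noteq> z"
    then obtain U where "openin X U" "(y \<in> U) \<noteq> (z \<in> U)" using sep[of y z] topY by auto
    moreover from this have "openin Y (U \<inter> (topspace X - {x}))"
      by (auto simp: Y_def openin_subtopology)
    ultimately show "\<exists>U. openin Y U \<and> (y \<notin> U \<longleftrightarrow> z \<in> U)" using yz topY by blast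
  qed
  then have YFix: "Y \<in> Fix \<U> P" using YTop T1_Fix by (simp add: Top\<^sub>0_def)
  define B where "B = Omega P Y"
  define v where "v = lifted_open P Y B (theta P Y)"
  have v: "frame_iso (O_ob P B) (frame_of_opens Y) v"
    using lifted_open_iso[OF is_Omega_Omega[OF YC]] by (simp add: B_def v_def)
  have B: "B \<in> Ob (cat P)" using Omega_Ob[OF is_Omega_Omega[OF YC]] by (simp add: B_def)
  \<comment> \<open>The isomorphisms \<open>\<O>(B) \<cong> \<Omega>Y \<cong> \<Omega>X \<cong> \<O>(A)\<close> place \<open>B\<close> in the fiber of \<open>\<O>(A)\<close>.\<close>
  from frame_iso_inverseE[OF u] obtain u' where u': "frame_iso (frame_of_opens X) (O_ob P A) u'"
    "\<And>U. U \<in> carrier (frame_of_opens X) \<Longrightarrow> u (u' U) = U" by metis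
  from frame_iso_inverseE[OF r] obtain r' where r': "frame_iso (frame_of_opens Y) (frame_of_opens X) r'"
    "\<And>U. U \<in> carrier (frame_of_opens X) \<Longrightarrow> r' ((\<lambda>U\<in>carrier (frame_of_opens X). U - {x}) U) = U" by metis
  from frame_iso_inverseE[OF v] obtain v' where v': "frame_iso (frame_of_opens Y) (O_ob P B) v'"
    "\<And>V. V \<in> carrier (frame_of_opens Y) \<Longrightarrow> v (v' V) = V" by metis
  define \<phi> where "\<phi> = compose (O_set P B) u' (compose (O_set P B) r' v)"
  have "frame_iso (O_ob P B) (O_ob P A) \<phi>"
    unfolding \<phi>_def using frame_O A B frame_opens u'(1) r'(1) v
    by (intro frame_iso_compose[where L = "frame_of_opens X"]
        frame_iso_compose[where L = "frame_of_opens Y"]) auto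
  then have "(B, \<phi>) \<in> fiber P (O_ob P A)" using B by (simp add: fiber_def)
  then have "fiber_le P (B, \<phi>) (A, frame_id (O_ob P A))"
    using At by (simp add: fiber_terminal_def)
  then obtain p where p: "p \<in> Hom (cat P) B A"
    and p_eq: "compose (O_set P B) (frame_id (O_ob P A)) (O_arr P B A p) = \<phi>"
    by (auto simp: fiber_le_def)
  have p_eq: "O_arr P B A p b = \<phi> b" if "b \<in> O_set P B" for b
    using fun_cong[OF p_eq, of b] that frame_homD(1)[OF O_arr_hom[OF B A p] that]
    by (simp add: compose_def)
  \<comment> \<open>Restricted along \<open>p\<close>, the point \<open>x\<close> becomes a point of \<open>Y\<close>, since \<open>Y\<close> is a fixed space.\<close>
  let ?s = "sigma (pfc_T P) X x"
  have s: "?s \<in> Hom (cat P) A (two_ob P)"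
    using T.sigma_point(1)[OF XT x] by (simp add: A_def)
  have "sigma P Y ` topspace Y = Hom (cat P) B (two_ob P)"
    using YFix topspace_pt\<^sub>C[OF B] homeomorphic_imp_surjective_map by (fastforce simp: Fix_def B_def)
  then obtain y where y: "y \<in> topspace Y" and
    y_eq: "sigma P Y y = Comp (cat P) B A (two_ob P) ?s p"
    using Comp_in[OF B A two_ob p s] by (metis imageE)
  have "x \<in> U \<longleftrightarrow> y \<in> U" if U: "openin X U" for U
  proof -
    have Uc: "U \<in> carrier (frame_of_opens X)" using U by (simp add: frame_of_opens_simps)
    have rU: "U - {x} \<in> carrier (frame_of_opens Y)"
      using frame_homD(1)[OF frame_iso_hom[OF r] Uc] Uc by simp
    define b where "b = v' (U - {x})"
    have b: "b \<in> O_set P B" unfolding b_def by (rule frame_homD(1)[OF frame_iso_hom[OF v'(1)] rU])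
    have vb: "v b = U - {x}" using v'(2)[OF rU] by (simp add: b_def)
    have \<phi>b: "\<phi> b = u' U" using b vb r'(2)[OF Uc] Uc by (simp add: \<phi>_def compose_def)
    have u'U: "u' U \<in> O_set P A" by (rule frame_homD(1)[OF frame_iso_hom[OF u'(1)] Uc])
    have "x \<in> U \<longleftrightarrow> x \<in> u (u' U)" using u'(2)[OF Uc] by simp
    also have "\<dots> \<longleftrightarrow> iota P (O_arr P A (two_ob P) ?s (u' U))"
      using T.sigma_point(2)[OF XT x] u'U by (simp add: A_def u_def)
    also have "\<dots> \<longleftrightarrow> iota P (O_arr P B (two_ob P) (sigma P Y y) b)"
      by (simp add: y_eq O_arr_Comp[OF B A two_ob p s] compose_def b p_eq \<phi>b)
    also have "\<dots> \<longleftrightarrow> y \<in> v b"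
      using sigma_point(2)[OF YC y] b by (simp add: B_def v_def)
    also have "\<dots> \<longleftrightarrow> y \<in> U" using y topY by (simp add: vb)
    finally show ?thesis .
  qed
  then have "x = y" using sep[of x y] x y topY by blast
  then show False using y topY by simp
qed


section \<open>Fixed spaces of fiber-initial objects\<close>

context total_sfc_category
begin

text \<open>
  The free object on a frame \<open>L\<close> is fiber-initial, because the unit is invertible: the inverse of an
  isomorphism \<open>\<O>(D) \<cong> \<O>(A)\<close>, precomposed with the unit, extends to an arrow \<open>A \<rightarrow> D\<close>.  The map \<open>u\<close>
  below is the unit at \<open>L\<close>, and the last clause its universal property without uniqueness.
\<close>

lemma fiber_initial_over_frame:
  assumes L: "L \<in> Ob (Frm \<U>)"
  obtains A u where "fiber_initial P A" "frame_iso L (O_ob P A) u"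
    "\<And>D h. D \<in> Ob (cat P) \<Longrightarrow> h \<in> frame_hom L (O_ob P D) \<Longrightarrow>
      \<exists>g\<in>Hom (cat P) A D. \<forall>l\<in>carrier L. O_arr P A D g (u l) = h l"
proof -
  from T3 obtain F0 F1 \<eta> where
    adj: "is_left_adjoint (cat P) (Frm \<U>) (O_ob P) (O_arr P) F0 F1 \<eta>"
    and iso: "is_iso (Frm \<U>) L (O_ob P (F0 L)) (\<eta> L)" using L by blast
  have FL: "F0 L \<in> Ob (cat P)" using adj L by (auto simp: is_left_adjoint_def is_functor_def)
  have u: "frame_iso L (O_ob P (F0 L)) (\<eta> L)"
    using iso by (simp add: is_iso_def frame_iso_def Frm_def)
  have ext: "\<exists>g\<in>Hom (cat P) (F0 L) D. \<forall>l\<in>carrier L. O_arr P (F0 L) D g (\<eta> L l) = h l"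
    if D: "D \<in> Ob (cat P)" and h: "h \<in> frame_hom L (O_ob P D)" for D h
  proof -
    have "\<exists>g. g \<in> Hom (cat P) (F0 L) D \<and> compose (carrier L) (O_arr P (F0 L) D g) (\<eta> L) = h"
      using adj L D h unfolding is_left_adjoint_def by (simp add: Frm_def) blast
    then show ?thesis by (auto simp: compose_def)
  qed
  have "fiber_initial P (F0 L)"
    unfolding fiber_initial_def
  proof (intro conjI ballI FL)
    fix z assume "z \<in> fiber P (O_ob P (F0 L))"
    then obtain D \<theta> where z: "z = (D, \<theta>)" and D: "D \<in> Ob (cat P)"
      and \<theta>: "frame_iso (O_ob P D) (O_ob P (F0 L)) \<theta>" by (auto simp: fiber_def)
    from frame_iso_inverseE[OF \<theta>] obtain \<theta>' where
      \<theta>': "frame_iso (O_ob P (F0 L)) (O_ob P D) \<theta>'" "\<And>b. b \<in> O_set P (F0 L) \<Longrightarrow> \<theta> (\<theta>' b) = b"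
      by metis
    have "compose (carrier L) \<theta>' (\<eta> L) \<in> frame_hom L (O_ob P D)"
      using L u \<theta>'(1) by (auto simp: Frm_def intro: frame_hom_compose frame_iso_hom)
    from ext[OF D this] obtain g where g: "g \<in> Hom (cat P) (F0 L) D"
      "\<And>l. l \<in> carrier L \<Longrightarrow> O_arr P (F0 L) D g (\<eta> L l) = \<theta>' (\<eta> L l)"
      by (auto simp: compose_def)
    have "\<theta> (O_arr P (F0 L) D g a) = a" if a: "a \<in> O_set P (F0 L)" for a
    proof -
      obtain l where "l \<in> carrier L" "a = \<eta> L l"
        using frame_iso_bij[OF u] a by (auto simp: bij_betw_def)
      then show ?thesis using g(2) \<theta>'(2)[OF a] by simp
    qed
    then have "compose (O_set P (F0 L)) \<theta> (O_arr P (F0 L) D g) = frame_id (O_ob P (F0 L))"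
      by (auto simp: compose_def)
    then show "fiber_le P (F0 L, frame_id (O_ob P (F0 L))) z"
      using g(1) by (auto simp: z fiber_le_def)
  qed
  then show thesis using u ext by (rule that)
qed

text \<open>
  Lifting out of any fiber-initial object: map it into the free object on its frame, over the unit,
  and then use the universal property.
\<close>

lemma fiber_initial_lifts:
  assumes A: "fiber_initial P A" and D: "D \<in> Ob (cat P)"
    and h: "h \<in> frame_hom (O_ob P A) (O_ob P D)"
  shows "lifts P A D h"
proof -
  have AO: "A \<in> Ob (cat P)" using A by (simp add: fiber_initial_def)
  obtain B u where B: "fiber_initial P B" and u: "frame_iso (O_ob P A) (O_ob P B) u"
    and ext: "\<And>D h. D \<in> Ob (cat P) \<Longrightarrow> h \<in> frame_hom (O_ob P A) (O_ob P D) \<Longrightarrow>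
      \<exists>g\<in>Hom (cat P) B D. \<forall>l\<in>O_set P A. O_arr P B D g (u l) = h l"
    using fiber_initial_over_frame[OF O_small[OF AO]] by metis
  have BO: "B \<in> Ob (cat P)" using B by (simp add: fiber_initial_def)
  from frame_iso_inverseE[OF u] obtain u' where u': "frame_iso (O_ob P B) (O_ob P A) u'"
    "\<And>b. b \<in> O_set P B \<Longrightarrow> u (u' b) = b" by metis
  have "(B, u') \<in> fiber P (O_ob P A)" using BO u' by (simp add: fiber_def)
  then have "fiber_le P (A, frame_id (O_ob P A)) (B, u')"
    using A by (simp add: fiber_initial_def)
  then obtain p where p: "p \<in> Hom (cat P) A B"
    and p_eq: "compose (O_set P A) u' (O_arr P A B p) = frame_id (O_ob P A)"
    by (auto simp: fiber_le_def)
  have pu: "O_arr P A B p a = u a" if a: "a \<in> O_set P A" for a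
  proof -
    have "u' (O_arr P A B p a) = a" using fun_cong[OF p_eq, of a] a by (simp add: compose_def)
    then show ?thesis using u'(2)[OF frame_homD(1)[OF O_arr_hom[OF AO BO p] a]] by simp
  qed
  obtain g where g: "g \<in> Hom (cat P) B D" "\<And>l. l \<in> O_set P A \<Longrightarrow> O_arr P B D g (u l) = h l"
    using ext[OF D h] by blast
  have "O_arr P A D (Comp (cat P) A B D g p) = h"
  proof
    fix a show "O_arr P A D (Comp (cat P) A B D g p) a = h a"
      using frame_hom_extensional[OF h]
      by (auto simp: O_arr_Comp[OF AO BO D p g(1)] compose_def pu g(2) PiE_def extensional_def)
  qed
  then show ?thesis using Comp_in[OF AO BO D p g(1)] by (auto simp: lifts_def)
qed

text \<open>
  The fiber-initial object over the frame of open sets is a cartesian lift, since lifting out of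
  fiber-initial objects amounts to being a frame homomorphism, which is detected by the points.
\<close>

lemma Top_I_eq: "Top\<^sub>C \<U> (pfc_I P) = (Top \<U> :: 'u topology set)"
proof (intro equalityI subsetI)
  fix X :: "'u topology" assume X: "X \<in> Top \<U>"
  interpret I: pfc_category \<U> "pfc_I P"
    unfolding pfc_I_def using pfc_category_axioms T2_two_ob(1) by (rule pfc_full_subcategory)
  obtain L g where L: "L \<in> Ob (Frm \<U>)" and g: "frame_iso L (frame_of_opens X) g"
    by (rule small_frame_of_opens[OF X])
  obtain A u where A: "fiber_initial P A" and u: "frame_iso L (O_ob P A) u"
    using fiber_initial_over_frame[OF L] by metis
  have AO: "A \<in> Ob (cat P)" using A by (simp add: fiber_initial_def)
  from frame_iso_inverseE[OF u] obtain u' where u': "frame_iso (O_ob P A) L u'" by metis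
  define w where "w = compose (O_set P A) g u'"
  have w: "frame_iso (O_ob P A) (frame_of_opens X) w"
    unfolding w_def using L frame_O[OF AO] frame_opens u' g
    by (intro frame_iso_compose) (auto simp: Frm_def)
  from frame_iso_inverseE[OF w] obtain w' where w': "frame_iso (frame_of_opens X) (O_ob P A) w'"
    "\<And>a. a \<in> O_set P A \<Longrightarrow> w' (w a) = a" by metis
  have wo: "openin X (w a)" if "a \<in> O_set P A" for a
    using frame_homD(1)[OF frame_iso_hom[OF w] that] by (simp add: frame_of_opens_simps)
  define \<theta> where "\<theta> = (\<lambda>a\<in>O_set P A. \<lambda>x\<in>topspace X. x \<in> w a)"
  have "bij_betw ((\<lambda>U. \<lambda>x\<in>topspace X. x \<in> U) \<circ> w) (O_set P A) (Top_hom X sierpinski)"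
    using frame_iso_bij[OF w] Top_hom_sierpinski_bij[of X] unfolding frame_of_opens_simps
    by (rule bij_betw_trans)
  then have bij: "bij_betw \<theta> (O_set P A) (Top_hom X sierpinski)"
    by (rule bij_betw_cong[THEN iffD1, rotated]) (simp add: \<theta>_def)
  then have \<theta>in: "\<theta> a \<in> Top_hom X sierpinski" if "a \<in> O_set P A" for a
    using that by (auto simp: bij_betw_def)
  have "is_Omega (pfc_I P) X A \<theta>"
    unfolding is_Omega_def cartesian_lift_def
  proof (intro conjI ballI)
    show "A \<in> Ob (cat (pfc_I P))" using A by simp
    show "\<theta> \<in> O_set (pfc_I P) A \<rightarrow>\<^sub>E Top_hom X sierpinski" using \<theta>in by (auto simp: \<theta>_def)
    show "bij_betw \<theta> (O_set (pfc_I P) A) (Top_hom X sierpinski)" using bij by simp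
    fix D h assume "D \<in> Ob (cat (pfc_I P))" and "h \<in> O_set (pfc_I P) D \<rightarrow>\<^sub>E O_set (pfc_I P) A"
    then have D: "fiber_initial P D" "D \<in> Ob (cat P)" and h: "h \<in> O_set P D \<rightarrow>\<^sub>E O_set P A"
      by (simp_all add: fiber_initial_def)
    have hc: "h d \<in> O_set P A" if "d \<in> O_set P D" for d using h that by auto
    \<comment> \<open>On fiber-initial domains, lifting means being a frame homomorphism.\<close>
    have lifts: "lifts (pfc_I P) D E k \<longleftrightarrow> k \<in> frame_hom (O_ob P D) (O_ob P E)"
      if "E \<in> Ob (cat P)" for E k
      using fiber_initial_lifts[OF D(1) that] lifts_frame_hom[OF _ D(2) that]
      by (auto simp: lifts_def)
    have wh: "compose (O_set P D) w h \<in> O_set P D \<rightarrow>\<^sub>E carrier (frame_of_opens X)"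
      using hc wo by (auto simp: compose_def frame_of_opens_simps)
    have "lifts (pfc_I P) D A h \<longleftrightarrow> h \<in> frame_hom (O_ob P D) (O_ob P A)" by (rule lifts[OF AO])
    also have "\<dots> \<longleftrightarrow> compose (O_set P D) w h \<in> frame_hom (O_ob P D) (frame_of_opens X)"
    proof
      assume "compose (O_set P D) w h \<in> frame_hom (O_ob P D) (frame_of_opens X)"
      from frame_hom_compose[OF frame_O[OF D(2)] this frame_iso_hom[OF w'(1)]]
      have "compose (O_set P D) w' (compose (O_set P D) w h) \<in> frame_hom (O_ob P D) (O_ob P A)" .
      moreover have "compose (O_set P D) w' (compose (O_set P D) w h) = h"
        using h hc w'(2) by (auto simp: compose_def PiE_def extensional_def fun_eq_iff)
      ultimately show "h \<in> frame_hom (O_ob P D) (O_ob P A)" by simp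
    qed (rule frame_hom_compose[OF frame_O[OF D(2)] _ frame_iso_hom[OF w]])
    also have "\<dots> \<longleftrightarrow> (\<forall>x\<in>topspace X. (\<lambda>d\<in>O_set P D. x \<in> w (h d)) \<in> frame_hom (O_ob P D) two_frame)"
      unfolding frame_hom_opens_iff[OF frame_O[OF D(2)] wh]
      by (simp add: compose_def cong: restrict_cong)
    also have "\<dots> \<longleftrightarrow> (\<forall>x\<in>topspace X. lifts (pfc_I P) D (two_ob P)
        (\<lambda>d\<in>O_set P D. chi (pfc_I P) X x (\<theta> (h d))))"
    proof (rule ball_cong[OF refl])
      fix x assume x: "x \<in> topspace X"
      have "chi (pfc_I P) X x (\<theta> (h d)) = iota_inv (x \<in> w (h d))" if "d \<in> O_set P D" for d
        using x \<theta>in[OF hc[OF that]] hc[OF that] by (simp add: chi_def \<theta>_def)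
      then have "(\<lambda>d\<in>O_set P D. chi (pfc_I P) X x (\<theta> (h d))) =
          (\<lambda>d\<in>O_set P D. iota_inv (x \<in> w (h d)))" by (rule restrict_ext)
      then show "((\<lambda>d\<in>O_set P D. x \<in> w (h d)) \<in> frame_hom (O_ob P D) two_frame) =
          lifts (pfc_I P) D (two_ob P) (\<lambda>d\<in>O_set P D. chi (pfc_I P) X x (\<theta> (h d)))"
        by (simp only: lifts[OF two_ob] frame_hom_two_iff[OF frame_O[OF D(2)]])
    qed
    finally show "lifts (pfc_I P) D A h \<longleftrightarrow> (\<forall>f\<in>chi (pfc_I P) X ` topspace X.
        lifts (pfc_I P) D (two_ob (pfc_I P)) (\<lambda>d\<in>O_set (pfc_I P) D. f (\<theta> (h d))))"
      by simp
  qed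
  with X show "X \<in> Top\<^sub>C \<U> (pfc_I P)" by (auto simp: Top\<^sub>C_def)
qed (simp add: Top\<^sub>C_def)

text \<open>
  Arrows from a fiber-initial object to \<open>\<two>\<close> are exactly the points of its frame.  The frame is
  replaced by an isomorphic one \<open>M\<close>, so that the lemma applies directly to \<open>M = frame_of_opens X\<close>.
\<close>

lemma pt_fiber_initial_homeomorphic:
  assumes A: "fiber_initial P A" and M: "frame M"
    and w: "frame_iso (O_ob P A) M w" and w': "frame_iso M (O_ob P A) w'"
    and w'w: "\<And>a. a \<in> O_set P A \<Longrightarrow> w' (w a) = a" and ww': "\<And>b. b \<in> carrier M \<Longrightarrow> w (w' b) = b"
  shows "homeomorphic_map (pt\<^sub>C P A) (pt M)
    (\<lambda>f. \<lambda>b\<in>carrier M. iota P (O_arr P A (two_ob P) f (w' b)))"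
    (is "homeomorphic_map _ _ ?T")
proof -
  let ?two = "two_ob P"
  have AO: "A \<in> Ob (cat P)" using A by (simp add: fiber_initial_def)
  have wc: "w a \<in> carrier M" if "a \<in> O_set P A" for a
    by (rule frame_homD(1)[OF frame_iso_hom[OF w] that])
  have w'c: "w' b \<in> O_set P A" if "b \<in> carrier M" for b
    by (rule frame_homD(1)[OF frame_iso_hom[OF w'] that])
  have topM: "topspace (pt M) = frame_hom M two_frame"
  proof -
    have "{f \<in> frame_hom M two_frame. f \<top>\<^bsub>M\<^esub>} = frame_hom M two_frame"
      by (auto simp: frame_homD(4) two_simps)
    then have "openin (pt M) (frame_hom M two_frame)"
      unfolding openin_pt[OF M] using frame_closed(3)[OF M] by blast
    moreover have "U \<subseteq> frame_hom M two_frame" if "openin (pt M) U" for U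
      using that unfolding openin_pt[OF M] by blast
    ultimately show ?thesis by (metis openin_subset openin_topspace subset_antisym)
  qed
  note topA = topspace_pt\<^sub>C[OF AO]
  have TM: "?T f \<in> frame_hom M two_frame" if f: "f \<in> Hom (cat P) A ?two" for f
  proof -
    have "compose (carrier M) (compose (O_set P A) (iota P) (O_arr P A ?two f)) w' \<in> frame_hom M two_frame"
      by (rule frame_hom_compose[OF M frame_iso_hom[OF w']
            frame_hom_compose[OF frame_O[OF AO] O_arr_hom[OF AO two_ob f] frame_iso_hom[OF iota_iso]]])
    moreover have "compose (carrier M) (compose (O_set P A) (iota P) (O_arr P A ?two f)) w' = ?T f"
      using w'c by (auto simp: compose_def)
    ultimately show ?thesis by simp
  qed
  have Tw: "?T f (w a) = iota P (O_arr P A ?two f a)" if "a \<in> O_set P A" for f a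
    using that wc w'w by simp
  have inj: "inj_on ?T (Hom (cat P) A ?two)"
  proof (rule inj_onI)
    fix f g assume f: "f \<in> Hom (cat P) A ?two" and g: "g \<in> Hom (cat P) A ?two" and eq: "?T f = ?T g"
    note hf = O_arr_hom[OF AO two_ob f] and hg = O_arr_hom[OF AO two_ob g]
    have "O_arr P A ?two f a = O_arr P A ?two g a" if a: "a \<in> O_set P A" for a
    proof -
      have "iota P (O_arr P A ?two f a) = iota P (O_arr P A ?two g a)"
        using fun_cong[OF eq, of "w a"] by (simp only: Tw[OF a])
      from arg_cong[OF this, of iota_inv] show ?thesis
        by (simp only: iota_inv(3) frame_homD(1)[OF hf a] frame_homD(1)[OF hg a])
    qed
    then have "O_arr P A ?two f = O_arr P A ?two g"
      using frame_hom_extensional[OF hf] frame_hom_extensional[OF hg] by (metis PiE_ext)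
    then show "f = g" by (rule O_arr_inject[OF AO two_ob f g])
  qed
  have surj: "\<exists>f\<in>Hom (cat P) A ?two. ?T f = k" if k: "k \<in> frame_hom M two_frame" for k
  proof -
    have "(\<lambda>a\<in>O_set P A. k (w a)) \<in> frame_hom (O_ob P A) two_frame"
      using frame_hom_compose[OF frame_O[OF AO] frame_iso_hom[OF w] k] by (simp add: compose_def)
    then have "(\<lambda>a\<in>O_set P A. iota_inv (k (w a))) \<in> frame_hom (O_ob P A) (O_ob P ?two)"
      by (simp only: frame_hom_two_iff[OF frame_O[OF AO]])
    from fiber_initial_lifts[OF A two_ob this] obtain f where f: "f \<in> Hom (cat P) A ?two"
      "O_arr P A ?two f = (\<lambda>a\<in>O_set P A. iota_inv (k (w a)))" by (auto simp: lifts_def)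
    have "?T f = k"
      using w'c ww' frame_hom_extensional[OF k]
      by (auto simp: f(2) iota_inv PiE_def extensional_def fun_eq_iff)
    with f(1) show ?thesis by blast
  qed
  show ?thesis
  proof (rule bijective_open_imp_homeomorphic_map)
    show "continuous_map (pt\<^sub>C P A) (pt M) ?T"
      unfolding continuous_map_def topM topA
    proof (intro conjI allI impI)
      show "?T \<in> Hom (cat P) A ?two \<rightarrow> frame_hom M two_frame" using TM by blast
      fix V assume "openin (pt M) V"
      then obtain b where b: "b \<in> carrier M" "V = {f \<in> frame_hom M two_frame. f b}"
        unfolding openin_pt[OF M] by blast
      have "{f \<in> Hom (cat P) A ?two. ?T f \<in> V} =
          {f \<in> Hom (cat P) A ?two. iota P (O_arr P A ?two f (w' b))}"
        using TM b by auto
      then show "openin (pt\<^sub>C P A) {f \<in> Hom (cat P) A ?two. ?T f \<in> V}"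
        unfolding openin_pt\<^sub>C[OF AO] using w'c[OF b(1)] by blast
    qed
    show "open_map (pt\<^sub>C P A) (pt M) ?T"
      unfolding open_map_def
    proof (intro allI impI)
      fix U assume "openin (pt\<^sub>C P A) U"
      then obtain a where a: "a \<in> O_set P A"
        "U = {f \<in> Hom (cat P) A ?two. iota P (O_arr P A ?two f a)}"
        unfolding openin_pt\<^sub>C[OF AO] by blast
      have "?T ` U = {k \<in> frame_hom M two_frame. k (w a)}"
      proof (intro equalityI subsetI)
        fix k assume "k \<in> ?T ` U"
        then show "k \<in> {k \<in> frame_hom M two_frame. k (w a)}"
          using TM Tw[OF a(1)] a(2) by auto
      next
        fix k assume "k \<in> {k \<in> frame_hom M two_frame. k (w a)}"
        then obtain f where "f \<in> Hom (cat P) A ?two" "?T f = k" "k (w a)" using surj by blast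
        moreover from this have "iota P (O_arr P A ?two f a)" using Tw[OF a(1), of f] by simp
        ultimately show "k \<in> ?T ` U" using a(2) by blast
      qed
      then show "openin (pt M) (?T ` U)" unfolding openin_pt[OF M] using wc[OF a(1)] by blast
    qed
    show "?T ` topspace (pt\<^sub>C P A) = topspace (pt M)"
      unfolding topA topM using TM surj by blast
    show "inj_on ?T (topspace (pt\<^sub>C P A))" unfolding topA by (rule inj)
  qed
qed

text \<open>
  Under the homeomorphism \<open>T\<close> between the two spaces of points, the unit \<open>\<sigma>\<close> at \<open>X\<close> becomes the
  canonical map into the space of points of the frame of open sets.
\<close>

lemma Fix_I_iff_sober:
  fixes X :: "'u topology"
  assumes X: "X \<in> Top \<U>"
  shows "X \<in> Fix \<U> (pfc_I P) \<longleftrightarrow> sober_space X"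
proof -
  interpret I: pfc_category \<U> "pfc_I P"
    unfolding pfc_I_def using pfc_category_axioms T2_two_ob(1) by (rule pfc_full_subcategory)
  have XI: "X \<in> Top\<^sub>C \<U> (pfc_I P)" using X Top_I_eq by simp
  define A where "A = Omega (pfc_I P) X"
  define w where "w = lifted_open (pfc_I P) X A (theta (pfc_I P) X)"
  let ?\<sigma> = "sigma (pfc_I P) X" and ?\<Omega> = "frame_of_opens X"
  let ?e = "\<lambda>x. \<lambda>U\<in>carrier ?\<Omega>. x \<in> U"
  have A: "fiber_initial P A"
    using I.Omega_Ob[OF I.is_Omega_Omega[OF XI]] by (simp add: A_def)
  have w: "frame_iso (O_ob P A) ?\<Omega> w"
    using I.lifted_open_iso[OF I.is_Omega_Omega[OF XI]] by (simp add: A_def w_def)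
  obtain w' where w': "frame_iso ?\<Omega> (O_ob P A) w'" "\<And>a. a \<in> O_set P A \<Longrightarrow> w' (w a) = a"
    "\<And>U. U \<in> carrier ?\<Omega> \<Longrightarrow> w (w' U) = U"
    by (rule frame_iso_inverseE[OF w]) blast
  have w'c: "w' U \<in> O_set P A" if "U \<in> carrier ?\<Omega>" for U
    by (rule frame_homD(1)[OF frame_iso_hom[OF w'(1)] that])
  define T where "T = (\<lambda>f. \<lambda>U\<in>carrier ?\<Omega>. iota P (O_arr P A (two_ob P) f (w' U)))"
  have T: "homeomorphic_map (pt\<^sub>C P A) (pt ?\<Omega>) T"
    unfolding T_def by (rule pt_fiber_initial_homeomorphic[OF A frame_opens w w'])
  then obtain S where ST: "homeomorphic_maps (pt\<^sub>C P A) (pt ?\<Omega>) T S"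
    using homeomorphic_map_maps by blast
  have S: "homeomorphic_map (pt ?\<Omega>) (pt\<^sub>C P A) S"
    using ST homeomorphic_maps_sym homeomorphic_maps_map by blast
  have T\<sigma>: "T (?\<sigma> x) = ?e x" if x: "x \<in> topspace X" for x
    unfolding T_def
  proof (rule restrict_ext)
    fix U assume U: "U \<in> carrier ?\<Omega>"
    show "iota P (O_arr P A (two_ob P) (?\<sigma> x) (w' U)) \<longleftrightarrow> x \<in> U"
      using I.sigma_point(2)[OF XI x, folded A_def, folded w_def, of "w' U"] w'c[OF U] w'(3)[OF U]
      by simp
  qed
  have \<sigma>: "?\<sigma> x \<in> topspace (pt\<^sub>C P A)" if x: "x \<in> topspace X" for x
    using I.sigma_point(1)[OF XI x] topspace_pt\<^sub>C A by (simp add: A_def fiber_initial_def)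
  have S\<sigma>: "S (?e x) = ?\<sigma> x" if x: "x \<in> topspace X" for x
    using ST \<sigma>[OF x] by (simp add: homeomorphic_maps_def flip: T\<sigma>[OF x])
  have "homeomorphic_map X (pt\<^sub>C P A) ?\<sigma> \<longleftrightarrow> homeomorphic_map X (pt ?\<Omega>) ?e"
  proof
    assume "homeomorphic_map X (pt\<^sub>C P A) ?\<sigma>"
    from homeomorphic_map_compose[OF this T] show "homeomorphic_map X (pt ?\<Omega>) ?e"
      by (rule homeomorphic_map_eq) (use T\<sigma> in auto)
  next
    assume "homeomorphic_map X (pt ?\<Omega>) ?e"
    from homeomorphic_map_compose[OF this S] show "homeomorphic_map X (pt\<^sub>C P A) ?\<sigma>"
      by (rule homeomorphic_map_eq) (use S\<sigma> in auto)
  qed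
  moreover have "pt\<^sub>C (pfc_I P) A = pt\<^sub>C P A" by (simp add: pt\<^sub>C_def)
  ultimately show ?thesis using XI by (simp add: Fix_def sober_space_def A_def)
qed

end


section \<open>The two categories of fixed spaces\<close>

theorem theorem3p18:
  fixes \<U> :: "'u set set" and P :: "('o, 'm, 'u) pfc"
  assumes "total_sfc_category \<U> P"
  shows "Fix \<U> (pfc_I P) = (Sob \<U> :: 'u topology set) \<and>
         Fix \<U> (pfc_T P) \<subseteq> (Top\<^sub>D \<U> :: 'u topology set)"
proof
  interpret total_sfc_category \<U> P by fact
  have "Fix \<U> (pfc_I P) \<subseteq> (Top \<U> :: 'u topology set)"
    by (auto simp: Fix_def Top_I_eq)
  then show "Fix \<U> (pfc_I P) = (Sob \<U> :: 'u topology set)"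
    using Fix_I_iff_sober by (auto simp: Sob_def)
  show "Fix \<U> (pfc_T P) \<subseteq> (Top\<^sub>D \<U> :: 'u topology set)"
    using Fix_T_td_space by (auto simp: Top\<^sub>D_def Fix_def Top\<^sub>C_def)
qed

end
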